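(* Suppose that $\kappa>\lambda$ are cardinals, $\lambda$ is singular, $\operatorname{cf}\lambda\neq\operatorname{cf}\kappa$, the ultrafilter $D$ is $(\lambda^+,\kappa)$-regular, and at least one of the following holds: (a) $\lambda$ is a strong limit cardinal and $\operatorname{cf}S_\lambda(\lambda)<2^\kappa$ (in particular, this holds if $\lambda$ is a strong limit cardinal and $\lambda^{<\lambda}<2^\kappa$); or (b) $\lambda^{<\lambda}<\kappa$; or (c) $\kappa$ is regular and there is no set $\mathbf a\subseteq\lambda$ of regular cardinals with $|\mathbf a|<\lambda$, $\sup\mathbf a=\lambda$ and $\kappa\in\operatorname{pcf}\mathbf a$. Then either $D$ is $\lambda$-decomposable, or $D$ is $(\lambda',\kappa)$-regular for some $\lambda'<\lambda$.
   Context: We work in ZFC. For infinite cardinals $\mu,\lambda$, an ultrafilter $D$ over a set $I$ is $(\mu,\lambda)$-regular if there is an indexed family $(X_\alpha)_{\alpha<\lambda}$ of members of $D$ such that $\bigcap_{\alpha\in A}X_\alpha=\emptyset$ whenever $A\subseteq\lambda$ and $|A|=\mu$. $D$ is $\lambda$-decomposable if there is a function $f:I\to\lambda$ such that $f^{-1}(X)\notin D$ whenever $X\subseteq\lambda$ and $|X|<\lambda$. $S_\mu(X)$ is the set of all subsets of $X$ of cardinality $<\mu$, and $\operatorname{cf}S_\mu(\lambda)$ is the minimal cardinality of a subset $Y\subseteq S_\mu(\lambda)$ such that every element of $S_\mu(\lambda)$ is included in some element of $Y$. $\lambda^{<\mu}=\sup\{\lambda^{\mu'}\mid\mu'<\mu\}$.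 $\kappa\in\operatorname{pcf}\mathbf a$ means that $\mathbf a$ is a set of (distinct) regular cardinals and there is an ultrafilter $D'$ over $\mathbf a$ such that $\kappa=\operatorname{cf}\prod_{D'}\mathbf a$, the cofinality of the ultraproduct modulo $D'$ of the members of $\mathbf a$ with their usual orders. *)

theory Defs
  imports Main "HOL-Library.FuncSet"
begin

text \<open>
  Cardinals are the relations satisfying \<^const>\<open>card_order_on\<close> on their field, compared up to order
  isomorphism by \<^term>\<open>ordLess\<close>, \<^term>\<open>ordLeq\<close> and \<^term>\<open>ordIso\<close>.  The ordinals below a cardinal
  \<open>l\<close> are the elements of \<^term>\<open>Field l\<close>; the ordinal given by \<open>x\<close> is the initial segment
  \<open>below l x\<close>.
\<close>

unbundle cardinal_syntax

definition below :: "'a rel \<Rightarrow> 'a \<Rightarrow> 'a rel" where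
  "below l x = Restr l (underS l x)"

text \<open>\<^const>\<open>regularCard\<close> alone is vacuous for nonempty finite orders, hence \<^const>\<open>cinfinite\<close>.\<close>

definition regular_cardinal :: "'a rel \<Rightarrow> bool" where
  "regular_cardinal r \<longleftrightarrow> Card_order r \<and> cinfinite r \<and> regularCard r"

definition singular_cardinal :: "'a rel \<Rightarrow> bool" where
  "singular_cardinal r \<longleftrightarrow> Card_order r \<and> cinfinite r \<and> \<not> regularCard r"

definition strong_limit :: "'a rel \<Rightarrow> bool" where
  "strong_limit l \<longleftrightarrow> Card_order l \<and> cinfinite l \<and>
     (\<forall>m :: 'a rel. Card_order m \<and> m <o l \<longrightarrow> ctwo ^c m <o l)"

text \<open>
  Unlike \<^const>\<open>cofinal\<close>, domination here is not strict, so that it is meaningful for arbitrary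
  partial orders.
\<close>

definition dominating :: "'a set \<Rightarrow> 'a rel \<Rightarrow> bool" where
  "dominating A r \<longleftrightarrow> A \<subseteq> Field r \<and> (\<forall>x \<in> Field r. \<exists>y \<in> A. (x, y) \<in> r)"

definition cofinality :: "'a rel \<Rightarrow> 'a rel" where
  "cofinality r = (SOME c. (\<exists>A. dominating A r \<and> c = |A| ) \<and> (\<forall>B. dominating B r \<longrightarrow> c \<le>o |B| ))"

lemma cofinality_spec:
  assumes "Refl r"
  shows "(\<exists>A. dominating A r \<and> cofinality r = |A| ) \<and> (\<forall>B. dominating B r \<longrightarrow> cofinality r \<le>o |B| )"
proof -
  let ?C = "{|A| | A. dominating A r}"
  have "dominating (Field r) r"
    using assms by (auto simp: dominating_def refl_on_def)
  then have "?C \<noteq> {}" by blast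
  moreover have "\<forall>c \<in> ?C. Card_order c" by (auto simp: card_of_Card_order)
  ultimately have "\<exists>c \<in> ?C. \<forall>d \<in> ?C. c \<le>o d"
    by (rule exists_minim_Card_order)
  then have "\<exists>c :: 'a rel. (\<exists>A. dominating A r \<and> c = |A| ) \<and> (\<forall>B. dominating B r \<longrightarrow> c \<le>o |B| )"
    by blast
  then show ?thesis unfolding cofinality_def by (rule someI_ex)
qed

definition small_subsets :: "'m rel \<Rightarrow> 'a set \<Rightarrow> 'a set set" where
  "small_subsets m X = {A. A \<subseteq> X \<and> |A| <o m}"

text \<open>\<open>cf S\<^sub>m(l)\<close>: the cofinality of \<^term>\<open>small_subsets m (Field l)\<close> ordered by inclusion.\<close>

definition cf_small_subsets :: "'m rel \<Rightarrow> 'a rel \<Rightarrow> 'a set rel" where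
  "cf_small_subsets m l =
     cofinality {(A, B). A \<in> small_subsets m (Field l) \<and> B \<in> small_subsets m (Field l) \<and> A \<subseteq> B}"

text \<open>
  The supremum of a set of cardinals on the type \<^typ>\<open>'a\<close>.  It always exists on that same type,
  since \<^term>\<open>|UNIV :: 'a set|\<close> is an upper bound.
\<close>

definition card_sup :: "'a rel set \<Rightarrow> 'a rel" where
  "card_sup R = (SOME s. Card_order s \<and> (\<forall>r \<in> R. r \<le>o s) \<and>
     (\<forall>t :: 'a rel. Card_order t \<and> (\<forall>r \<in> R. r \<le>o t) \<longrightarrow> s \<le>o t))"

lemma card_sup_spec:
  fixes R :: "'a rel set"
  assumes "\<forall>r \<in> R. Card_order r"
  shows "Card_order (card_sup R) \<and> (\<forall>r \<in> R. r \<le>o card_sup R) \<and>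
    (\<forall>t :: 'a rel. Card_order t \<and> (\<forall>r \<in> R. r \<le>o t) \<longrightarrow> card_sup R \<le>o t)"
proof -
  let ?U = "{t :: 'a rel. Card_order t \<and> (\<forall>r \<in> R. r \<le>o t)}"
  have "r \<le>o |UNIV :: 'a set|" if "r \<in> R" for r
    using that assms
    by (auto intro: ordIso_ordLeq_trans[OF ordIso_symmetric[OF card_of_Field_ordIso] card_of_mono1])
  then have "|UNIV :: 'a set| \<in> ?U" by (simp add: card_of_Card_order)
  then have "?U \<noteq> {}" by (metis empty_iff)
  moreover have "\<forall>t \<in> ?U. Card_order t" by simp
  ultimately have "\<exists>s \<in> ?U. \<forall>t \<in> ?U. s \<le>o t"
    by (rule exists_minim_Card_order)
  then have "\<exists>s :: 'a rel. Card_order s \<and> (\<forall>r \<in> R. r \<le>o s) \<and>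
      (\<forall>t :: 'a rel. Card_order t \<and> (\<forall>r \<in> R. r \<le>o t) \<longrightarrow> s \<le>o t)"
    by blast
  then show ?thesis unfolding card_sup_def by (rule someI_ex)
qed

definition cexp_less :: "'a rel \<Rightarrow> 'm rel \<Rightarrow> ('m \<Rightarrow> 'a) rel" where
  "cexp_less l m = card_sup {l ^c m' | m' :: 'm rel. Card_order m' \<and> m' <o m}"

definition ultrafilter_on :: "'i set \<Rightarrow> 'i set set \<Rightarrow> bool" where
  "ultrafilter_on I D \<longleftrightarrow>
     D \<subseteq> Pow I \<and> I \<in> D \<and> {} \<notin> D \<and>
     (\<forall>X \<in> D. \<forall>Y \<in> D. X \<inter> Y \<in> D) \<and>
     (\<forall>X \<in> D. \<forall>Y. X \<subseteq> Y \<and> Y \<subseteq> I \<longrightarrow> Y \<in> D) \<and>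
     (\<forall>X. X \<subseteq> I \<longrightarrow> X \<in> D \<or> I - X \<in> D)"

text \<open>\<open>(m, k)\<close>-regularity, for infinite cardinals \<open>m\<close> and \<open>k\<close>.\<close>

definition regular_ultrafilter :: "'m rel \<Rightarrow> 'k rel \<Rightarrow> 'i set set \<Rightarrow> bool" where
  "regular_ultrafilter m k D \<longleftrightarrow>
     (\<exists>X :: 'k \<Rightarrow> 'i set. (\<forall>x \<in> Field k. X x \<in> D) \<and>
        (\<forall>A. A \<subseteq> Field k \<and> |A| =o m \<longrightarrow> (\<Inter>x \<in> A. X x) = {}))"

definition decomposable :: "'a rel \<Rightarrow> 'i set \<Rightarrow> 'i set set \<Rightarrow> bool" where
  "decomposable l I D \<longleftrightarrow>
     (\<exists>f. f \<in> I \<rightarrow> Field l \<and> (\<forall>X. X \<subseteq> Field l \<and> |X| <o l \<longrightarrow> {i \<in> I. f i \<in> X} \<notin> D))"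

text \<open>The ultraproduct, modulo an ultrafilter \<open>D\<close> over \<open>R\<close>, of the members of a set \<open>R\<close> of orders.\<close>

definition ultraproduct_rel :: "'a rel set \<Rightarrow> 'a rel set set \<Rightarrow> ('a rel \<Rightarrow> 'a) rel" where
  "ultraproduct_rel R D =
     {(f, g). f \<in> Pi\<^sub>E R Field \<and> g \<in> Pi\<^sub>E R Field \<and> {r \<in> R. f r = g r} \<in> D}"

definition ultraproduct :: "'a rel set \<Rightarrow> 'a rel set set \<Rightarrow> ('a rel \<Rightarrow> 'a) set set" where
  "ultraproduct R D = Pi\<^sub>E R Field // ultraproduct_rel R D"

definition ultraproduct_order :: "'a rel set \<Rightarrow> 'a rel set set \<Rightarrow> ('a rel \<Rightarrow> 'a) set rel" where
  "ultraproduct_order R D =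
     {(F, G). F \<in> ultraproduct R D \<and> G \<in> ultraproduct R D \<and>
        (\<exists>f \<in> F. \<exists>g \<in> G. {r \<in> R. (f r, g r) \<in> r} \<in> D)}"

text \<open>
  \<open>k \<in> pcf R\<close>.  As cardinals are identified up to \<^const>\<open>ordIso\<close>, distinctness of the members of
  \<open>R\<close> means that they are pairwise non-isomorphic.
\<close>

definition in_pcf :: "'k rel \<Rightarrow> 'a rel set \<Rightarrow> bool" where
  "in_pcf k R \<longleftrightarrow>
     (\<forall>r \<in> R. regular_cardinal r) \<and> (\<forall>r \<in> R. \<forall>s \<in> R. r =o s \<longrightarrow> r = s) \<and>
     (\<exists>D. ultrafilter_on R D \<and> k =o cofinality (ultraproduct_order R D))"

end

theory Submission
  imports Defs
begin

text \<open>
  Work in the ultrapower modulo \<open>D\<close>, assuming that \<open>D\<close> is not \<open>l\<close>-decomposable, so that every function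
  into \<open>l\<close> has fewer than \<open>|l|\<close> values modulo \<open>D\<close>.  For regular \<open>r > l\<close> such that \<open>D\<close> is
  \<open>(l\<^sup>+, r)\<close>-regular but not \<open>(l', r)\<close>-regular for any \<open>l' < l\<close>, the constant functions below \<open>r\<close>
  have a least upper bound modulo \<open>D\<close>, since otherwise \<open>D\<close> would be \<open>(\<omega>, l)\<close>-regular and hence
  \<open>l\<close>-decomposable.  The cofinality of this bound is a regular cardinal below \<open>l\<close> in the ultrapower;
  it takes values in a set \<open>W\<close> of fewer than \<open>|l|\<close> regular cardinals, cofinal in \<open>l\<close>, and the
  ultraproduct of \<open>W\<close> has cofinality \<open>r\<close>.  This contradicts (c).  Under (a), each subset of \<open>r\<close> is
  determined by one of \<open>2\<^sup>l\<close> sets of codes together with a proper initial segment, and a diagonal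
  argument contradicts \<open>2\<^sup>l < 2\<^sup>r\<close>.  Under (b), the pigeonhole principle suffices.  A singular
  \<open>k\<close> is reduced to the regular cardinals below it; the bounds \<open>l'\<close> obtained for those can be made
  uniform because the cofinalities of \<open>l\<close> and \<open>k\<close> differ.
\<close>

subsection \<open>Well-orders and cardinals\<close>

text \<open>Two bounds pinch the cofinality of the least upper bound. A cover by sets of size at
  most \<open>|l|\<close> makes it at most \<open>|l|\<close>, hence smaller, because a cofinality
  is regular and \<open>l\<close> is not. If no cover by sets of one fixed smaller size exists, it
  exceeds every given cardinal below \<open>l\<close> at almost all indices. The obstacle is that
  cofinal sets, positions in them and codes all vary with the index. Indecomposability is the
  remedy: what is chosen at each index from at most \<open>|l|\<close> possibilities lies, modulo
  \<open>D\<close>, in one set \<open>V\<close> of fewer than \<open>|l|\<close> possibilities, and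
  \<open>V\<close> is almost always smaller than the cofinality, hence bounded. Under (c) this turns
  a function of the index into a function of the cofinality, as a product over \<open>W\<close>
  requires; under (a) it confines the difference of two subsets of \<open>r\<close> to a bounded
  part. The number \<open>2^l\<close> enters (a) because a strong limit \<open>l\<close> has only
  \<open>|l|\<close> bounded subsets, so there are \<open>2^l\<close> sets of codes; moreover
  \<open>2^l\<close> is at most the cofinality of the small subsets of \<open>l\<close>.\<close>

lemma Well_order_if_Card_order: "Card_order r \<Longrightarrow> Well_order r"
  by (simp add: card_order_on_def)

lemma wo_refl: "Well_order r \<Longrightarrow> x \<in> Field r \<Longrightarrow> (x, x) \<in> r"
  using wo_rel.REFL[of r] by (auto simp: wo_rel_def refl_on_def)

lemma wo_trans: "Well_order r \<Longrightarrow> (x, y) \<in> r \<Longrightarrow> (y, z) \<in> r \<Longrightarrow> (x, z) \<in> r"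
  using wo_rel.TRANS[of r] by (auto simp: wo_rel_def dest: transD)

lemma wo_antisym: "Well_order r \<Longrightarrow> (x, y) \<in> r \<Longrightarrow> (y, x) \<in> r \<Longrightarrow> x = y"
  using wo_rel.ANTISYM[of r] by (auto simp: wo_rel_def dest: antisymD)

lemma wo_cases:
  assumes "Well_order r" "x \<in> Field r" "y \<in> Field r"
  obtains "(x, y) \<in> r" | "y \<in> underS r x"
  using assms wo_rel.TOTALS[of r] by (auto simp: wo_rel_def underS_def)

lemma wo_not_less: "Well_order r \<Longrightarrow> (x, y) \<in> r \<Longrightarrow> y \<in> underS r x \<Longrightarrow> False"
  by (auto simp: underS_def dest: wo_antisym)

lemma wo_not_le_iff:
  "Well_order r \<Longrightarrow> x \<in> Field r \<Longrightarrow> y \<in> Field r \<Longrightarrow> (x, y) \<notin> r \<longleftrightarrow> y \<in> underS r x"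
  using wo_cases[of r x y] wo_not_less[of r x y] by blast

lemma wo_le_less_trans: "Well_order r \<Longrightarrow> (x, y) \<in> r \<Longrightarrow> y \<in> underS r z \<Longrightarrow> x \<in> underS r z"
  by (auto simp: underS_def dest: wo_antisym wo_trans)

lemma wo_less_le_trans: "Well_order r \<Longrightarrow> x \<in> underS r y \<Longrightarrow> (y, z) \<in> r \<Longrightarrow> x \<in> underS r z"
  by (auto simp: underS_def dest: wo_antisym wo_trans)

lemma underS_le: "x \<in> underS r y \<Longrightarrow> (x, y) \<in> r"
  by (simp add: underS_def)

lemma underS_in_Field: "x \<in> underS r y \<Longrightarrow> x \<in> Field r" "x \<in> underS r y \<Longrightarrow> y \<in> Field r"
  by (auto simp: underS_def Field_def)

lemma underS_subset_Field: "underS r y \<subseteq> Field r"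
  using underS_in_Field(1) by fast

lemma wo_least:
  assumes "Well_order r" "A \<subseteq> Field r" "A \<noteq> {}"
  obtains m where "m \<in> A" "\<And>a. a \<in> A \<Longrightarrow> (m, a) \<in> r"
  using assms wo_rel.Well_order_isMinim_exists[of r A]
  by (auto simp: wo_rel_def wo_rel.isMinim_def)

lemma wo_max2:
  assumes "Well_order r" "x \<in> Field r" "y \<in> Field r"
  obtains z where "z \<in> Field r" "(x, z) \<in> r" "(y, z) \<in> r"
proof (rule wo_cases[OF assms])
  assume "(x, y) \<in> r"
  then show thesis using that[of y] wo_refl[of r y] assms by simp
next
  assume "y \<in> underS r x"
  then show thesis using that[of x] wo_refl[of r x] assms underS_le[of y r x] by simp
qed

lemma underS_mono: "Well_order r \<Longrightarrow> (x, y) \<in> r \<Longrightarrow> underS r x \<subseteq> underS r y"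
  by (intro subsetI) (rule wo_less_le_trans)

lemma card_not_le_iff: "\<not> |A| \<le>o |B| \<longleftrightarrow> |B| <o |A|"
  by (rule not_ordLeq_iff_ordLess[OF card_of_Well_order card_of_Well_order])

lemma card_le_order: "Card_order r \<Longrightarrow> |A| \<le>o r \<longleftrightarrow> |A| \<le>o |Field r|"
  by (meson card_of_Field_ordIso ordIso_symmetric ordLeq_ordIso_trans)

lemma card_less_order: "Card_order r \<Longrightarrow> |A| <o r \<longleftrightarrow> |A| <o |Field r|"
  by (meson card_of_Field_ordIso ordIso_symmetric ordLess_ordIso_trans)

lemma order_less_card: "Card_order r \<Longrightarrow> r <o s \<longleftrightarrow> |Field r| <o s"
  by (meson card_of_Field_ordIso ordIso_symmetric ordIso_ordLess_trans)

lemma not_card_less_order: "Card_order r \<Longrightarrow> \<not> |A| <o r \<longleftrightarrow> r \<le>o |A|"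
  by (simp add: not_ordLess_iff_ordLeq card_of_Well_order Well_order_if_Card_order)

lemma card_less_underS:
  assumes "Card_order r" "|A| <o r"
  obtains w where "w \<in> Field r" "|A| =o below r w" "|A| =o |underS r w|"
proof -
  have wo: "Well_order r" using assms(1) by (rule Well_order_if_Card_order)
  obtain w where w: "w \<in> Field r" "|A| =o Restr r (underS r w)"
    using assms ordLess_iff_ordIso_Restr[OF wo card_of_Well_order] by blast
  have "Field (Restr r (underS r w)) = underS r w"
    by (rule Refl_Field_Restr2) (use wo in \<open>auto simp: underS_Field wo_rel.REFL wo_rel_def\<close>)
  then have "|A| =o |underS r w|"
    using card_of_cong[OF w(2)] by (simp add: Field_card_of)
  with w show thesis using that by (simp add: below_def)
qed

lemma card_underS_mono: "Well_order r \<Longrightarrow> (x, y) \<in> r \<Longrightarrow> |underS r x| \<le>o |underS r y|"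
  by (simp add: card_of_mono1 underS_mono)

lemma card_Times_le: "infinite C \<Longrightarrow> |A| \<le>o |C| \<Longrightarrow> |B| \<le>o |C| \<Longrightarrow> |A \<times> B| \<le>o |C|"
  by (simp add: card_of_Sigma_ordLeq_infinite)

lemma card_Times_less:
  assumes "infinite (Field r)" "Card_order r" "|A| <o r" "|B| <o r"
  shows "|A \<times> B| <o r"
proof (cases "finite A \<and> finite B")
  case True
  then have "|A \<times> B| <o |Field r|"
    using finite_ordLess_infinite[OF card_of_Well_order card_of_Well_order, of "A \<times> B" "Field r"] assms(1)
    by (simp add: Field_card_of)
  then show ?thesis using card_less_order[OF assms(2)] by metis
next
  case False
  define C where "C = A <+> B"
  have C: "infinite C" using False by (simp add: C_def)
  have AC: "|A| \<le>o |C|" "|B| \<le>o |C|" unfolding C_def by (rule card_of_Plus1 card_of_Plus2)+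
  have "|A \<times> B| \<le>o |C|"
    using C AC by (rule card_Times_le)
  moreover have "|C| <o r"
    unfolding C_def by (rule card_of_Plus_ordLess_infinite_Field[OF assms])
  ultimately show ?thesis by (rule ordLeq_ordLess_trans)
qed

lemma card_Pow_mono: "|A| \<le>o |B| \<Longrightarrow> |Pow A| \<le>o |Pow B|"
proof -
  assume "|A| \<le>o |B|"
  then obtain f where f: "inj_on f A" "f ` A \<subseteq> B" using card_of_ordLeq[of A B] by blast
  have "inj_on ((`) f) (Pow A)" "(`) f ` Pow A \<subseteq> Pow B"
    using f by (auto intro: inj_on_image_Pow)
  then show ?thesis using card_of_ordLeq[of "Pow A" "Pow B"] by blast
qed

lemma card_finite_subsets:
  assumes "infinite A"
  shows "|{X. X \<subseteq> A \<and> finite X}| \<le>o |A|"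
proof -
  have lists: "|{xs. set xs \<subseteq> A \<and> length xs = n}| \<le>o |A|" for n
  proof (induction n)
    case 0
    have "{xs. set xs \<subseteq> A \<and> length xs = 0} = {[]}" by auto
    then show ?case using card_of_singl_ordLeq[of A "[]"] assms by (metis finite.emptyI)
  next
    case (Suc n)
    have "{xs. set xs \<subseteq> A \<and> length xs = Suc n}
        \<subseteq> (\<lambda>(a, xs). a # xs) ` (A \<times> {xs. set xs \<subseteq> A \<and> length xs = n})"
      by (auto simp: length_Suc_conv)
    then have "|{xs. set xs \<subseteq> A \<and> length xs = Suc n}| \<le>o |A \<times> {xs. set xs \<subseteq> A \<and> length xs = n}|"
      by (rule surj_imp_ordLeq)
    also have "|A \<times> {xs. set xs \<subseteq> A \<and> length xs = n}| \<le>o |A|"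
      using assms card_of_mono1[OF subset_refl] Suc by (rule card_Times_le)
    finally show ?case .
  qed
  have "{X. X \<subseteq> A \<and> finite X} \<subseteq> set ` (\<Union>n. {xs. set xs \<subseteq> A \<and> length xs = n})"
    using finite_list by fastforce
  then have "|{X. X \<subseteq> A \<and> finite X}| \<le>o |\<Union>n. {xs. set xs \<subseteq> A \<and> length xs = n}|"
    by (rule surj_imp_ordLeq)
  also have "|\<Union>n. {xs. set xs \<subseteq> A \<and> length xs = n}| \<le>o |A|"
    using lists assms infinite_iff_card_of_nat by (intro card_of_UNION_ordLeq_infinite) auto
  finally show ?thesis .
qed

lemma infinite_no_max:
  assumes "Card_order r" "\<not> finite (Field r)" "x \<in> Field r"
  obtains y where "y \<in> Field r" "x \<in> underS r y"
  using infinite_Card_order_limit[OF assms(1,2,3)] underS_def that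
  by (metis (mono_tags, lifting) mem_Collect_eq)

lemma regular_stable:
  assumes "regular_cardinal r"
  shows "Card_order r" "Well_order r" "\<not> finite (Field r)" "stable r"
proof -
  show *: "Card_order r" "\<not> finite (Field r)"
    using assms by (auto simp: regular_cardinal_def cinfinite_def)
  then show "Well_order r" "stable r"
    using regularCard_stable[of r] assms by (auto simp: regular_cardinal_def card_order_on_def)
qed

lemma stable_small_bounded:
  assumes "regular_cardinal r" "B \<subseteq> Field r" "|B| <o r"
  obtains y where "y \<in> Field r" "\<And>x. x \<in> B \<Longrightarrow> x \<in> underS r y"
proof -
  note r = regular_stable[OF assms(1)]
  have "\<not> cofinal B r"
    using assms not_ordLess_ordIso by (auto simp: regular_cardinal_def regularCard_def)
  then obtain a where a: "a \<in> Field r" "\<And>b. b \<in> B \<Longrightarrow> (a, b) \<in> r \<Longrightarrow> a = b"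
    unfolding cofinal_def by blast
  obtain y where y: "y \<in> Field r" "a \<in> underS r y"
    using infinite_no_max[OF r(1,3) a(1)] .
  have "x \<in> underS r y" if "x \<in> B" for x
  proof -
    have "(x, a) \<in> r"
      using that assms(2) a wo_refl[OF r(2) a(1)] underS_le by (cases rule: wo_cases[OF r(2) a(1), of x]) auto
    then show ?thesis using wo_le_less_trans[OF r(2)] y(2) by blast
  qed
  with y that show thesis by blast
qed

text \<open>An infinite subset of a well-order contains a strictly increasing sequence, along which
  \<open>g\<close> would descend forever.\<close>

lemma finite_decreasing:
  assumes l: "Well_order l" and r: "Well_order r"
    and A: "A \<subseteq> Field l"
    and dec: "\<And>x y. x \<in> A \<Longrightarrow> y \<in> A \<Longrightarrow> x \<in> underS l y \<Longrightarrow> g y \<in> underS r (g x)"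
  shows "finite A"
proof (rule ccontr)
  assume inf: "infinite A"
  \<comment> \<open>Infinitely many larger members must remain so that the sequence can be
    continued; \<open>n\<close> is a dummy for \<open>dependent_nat_choice\<close>.\<close>
  define P where "P = (\<lambda>(n::nat) a. a \<in> A \<and> infinite {b \<in> A. a \<in> underS l b})"
  have step: "\<exists>m\<in>B. infinite {b \<in> B. m \<in> underS l b}" if B: "B \<subseteq> A" "infinite B" for B
  proof -
    have "B \<subseteq> Field l" "B \<noteq> {}" using B A by auto
    then obtain m where m: "m \<in> B" "\<And>a. a \<in> B \<Longrightarrow> (m, a) \<in> l"
      by (rule wo_least[OF l]) blast
    have "B \<subseteq> insert m {b \<in> B. m \<in> underS l b}"
      using m by (auto simp: underS_def)
    then show ?thesis using B(2) m(1) by (meson finite_insert finite_subset)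
  qed
  have "\<exists>f. \<forall>n. P n (f n) \<and> f n \<in> underS l (f (Suc n))"
  proof (rule dependent_nat_choice)
    show "\<exists>x. P 0 x" using step[of A] inf by (auto simp: P_def)
  next
    fix x n assume "P n x"
    then obtain m where m: "m \<in> {b \<in> A. x \<in> underS l b}"
        "infinite {b \<in> {b \<in> A. x \<in> underS l b}. m \<in> underS l b}"
      using step[of "{b \<in> A. x \<in> underS l b}"] by (auto simp: P_def)
    then have "infinite {b \<in> A. m \<in> underS l b}"
      by (rule_tac infinite_super[OF _ m(2)]) auto
    then show "\<exists>y. P (Suc n) y \<and> x \<in> underS l y" using m(1) by (auto simp: P_def)
  qed
  then obtain f where f: "\<And>n. f n \<in> A" "\<And>n. f n \<in> underS l (f (Suc n))"
    by (auto simp: P_def)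
  have "(g (f (Suc n)), g (f n)) \<in> r - Id" for n
    using dec[OF f(1) f(1) f(2)] by (auto simp: underS_def)
  then have "\<exists>h. \<forall>n. (h (Suc n), h n) \<in> r - Id"
    by (intro exI[of _ "\<lambda>n. g (f n)"]) blast
  moreover have "wf (r - Id)" using r by (simp add: well_order_on_def)
  ultimately show False unfolding wf_iff_no_infinite_down_chain by blast
qed

subsection \<open>Singular cardinals\<close>

locale singular =
  fixes l :: "'a rel"
  assumes singular: "singular_cardinal l"
begin

lemma card_l: "Card_order l" and wo_l: "Well_order l" and infinite_l: "infinite (Field l)"
  using singular by (auto simp: singular_cardinal_def cinfinite_def card_order_on_def)

lemma not_regular_l: "\<not> regularCard l"
  using singular by (simp add: singular_cardinal_def)

lemma short_cofinal:
  obtains E where "E \<subseteq> Field l" "cofinal E l" "|E| <o l"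
proof -
  obtain E where E: "E \<subseteq> Field l" "cofinal E l" "\<not> |E| =o l"
    using not_regular_l unfolding regularCard_def by blast
  have "|E| \<le>o l" using card_of_mono1[OF E(1)] card_le_order[OF card_l] by metis
  then have "|E| <o l" using E(3) ordLeq_iff_ordLess_or_ordIso by metis
  with E that show thesis by metis
qed

lemma regular_not_iso_l: "regular_cardinal r \<Longrightarrow> \<not> r =o l"
  using stable_ordIso1[of r l] stable_regularCard[OF card_l infinite_l] not_regular_l
    regular_stable(4) ordIso_symmetric stable_ordIso1 by metis

text \<open>The successor of a smaller cardinal is at most \<open>l\<close>, and a regular cardinal
  is not \<open>l\<close>. With \<open>r\<close> that successor, this says that \<open>l\<close> is
  a limit cardinal.\<close>

lemma regular_less_l:
  assumes "regular_cardinal r" "|A| <o l" "r \<le>o cardSuc |A|"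
  shows "r <o l"
proof -
  have "r \<le>o l"
    using assms(2,3) cardSuc_ordLess_ordLeq[OF card_of_Card_order card_l] ordLeq_transitive by metis
  then show ?thesis
    using regular_not_iso_l[OF assms(1)] ordLeq_iff_ordLess_or_ordIso by metis
qed

lemma regular_cardSuc: "infinite A \<Longrightarrow> regular_cardinal (cardSuc |A| )"
  using infinite_cardSuc_regularCard[OF _ card_of_Card_order, of A]
    cardSuc_Card_order[OF card_of_Card_order] card_of_cardSuc_finite[of A]
  by (simp add: regular_cardinal_def cinfinite_def Field_card_of)

text \<open>Omega is regular and hence strictly below the singular \<open>l\<close>.\<close>

lemma infinite_underS:
  obtains w where "w \<in> Field l" "infinite (underS l w)"
proof -
  have reg: "regular_cardinal natLeq"
    unfolding regular_cardinal_def cinfinite_def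
    by (intro conjI natLeq_Card_order regularCard_natLeq) (simp add: Field_natLeq)
  have "natLeq \<le>o |Field l|" using infinite_l infinite_iff_natLeq_ordLeq by metis
  then have "natLeq \<le>o l" using card_of_Field_ordIso[OF card_l] ordLeq_ordIso_trans by metis
  then have "natLeq <o l" using regular_not_iso_l[OF reg] ordLeq_iff_ordLess_or_ordIso by metis
  then have "|UNIV :: nat set| <o l" using card_of_nat ordIso_ordLess_trans by metis
  then obtain w where "w \<in> Field l" "|UNIV :: nat set| =o |underS l w|"
    using card_less_underS[OF card_l] by metis
  then show thesis
    using that card_of_ordIso_finite infinite_UNIV_nat by metis
qed

lemma small_finite: "finite A \<Longrightarrow> |A| <o l"
  using finite_ordLess_infinite[OF card_of_Well_order wo_l] infinite_l by (simp add: Field_card_of)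

lemma small_underS: "w \<in> Field l \<Longrightarrow> |underS l w| <o l"
  using card_of_underS[OF card_l] .

text \<open>The common bound is made infinite so that unions of that many sets of that size do not
  exceed it.\<close>

lemma underS_bound:
  assumes "|A| <o l" "|B| <o l"
  obtains w where "w \<in> Field l" "infinite (underS l w)" "|A| \<le>o |underS l w|" "|B| \<le>o |underS l w|"
proof -
  obtain u where u: "u \<in> Field l" "infinite (underS l u)" using infinite_underS by metis
  obtain a where a: "a \<in> Field l" "|A| =o |underS l a|"
    using card_less_underS[OF card_l assms(1)] by metis
  obtain b where b: "b \<in> Field l" "|B| =o |underS l b|"
    using card_less_underS[OF card_l assms(2)] by metis
  obtain c where c: "c \<in> Field l" "(a, c) \<in> l" "(b, c) \<in> l"
    using wo_max2[OF wo_l a(1) b(1)] by metis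
  obtain w where w: "w \<in> Field l" "(c, w) \<in> l" "(u, w) \<in> l"
    using wo_max2[OF wo_l c(1) u(1)] by metis
  have "(a, w) \<in> l" "(b, w) \<in> l" using wo_trans[OF wo_l _ w(2)] c by metis+
  then have "|A| \<le>o |underS l w|" "|B| \<le>o |underS l w|"
    using a(2) b(2) ordIso_ordLeq_trans card_underS_mono[OF wo_l] by metis+
  moreover have "infinite (underS l w)"
    using u(2) underS_mono[OF wo_l w(3)] finite_subset by metis
  ultimately show thesis using that w(1) by metis
qed

lemma small_Times: "|A| <o l \<Longrightarrow> |B| <o l \<Longrightarrow> |A \<times> B| <o l"
  by (rule card_Times_less[OF infinite_l card_l])

lemma small_Un: "|A| <o l \<Longrightarrow> |B| <o l \<Longrightarrow> |A \<union> B| <o l"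
  by (rule card_of_Un_ordLess_infinite_Field[OF infinite_l card_l])

lemma small_le: "|A| \<le>o |B| \<Longrightarrow> |B| <o l \<Longrightarrow> |A| <o l"
  by (rule ordLeq_ordLess_trans)

lemma small_image: "|A| <o l \<Longrightarrow> |f ` A| <o l"
  by (rule small_le[OF card_of_image])

end

subsection \<open>Regularity and decomposability in terms of the filter\<close>

text \<open>For a well-ordering \<open>k\<close>, \<open>covers F l (Field k)\<close> is \<open>(l\<^sup>+, k)\<close>-regularity, and
  \<open>few_covers F l (Field k)\<close> is \<open>(l', k)\<close>-regularity for some \<open>l' < l\<close>: a family \<open>X\<close> corresponds
  to the sets \<open>{x. i \<in> X x}\<close>.\<close>

definition covers :: "'i filter \<Rightarrow> 'a rel \<Rightarrow> 'b set \<Rightarrow> bool" where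
  "covers F l K \<longleftrightarrow> (\<exists>Y. (\<forall>i. |Y i| \<le>o l) \<and> (\<forall>x\<in>K. \<forall>\<^sub>F i in F. x \<in> Y i))"

definition few_covers :: "'i filter \<Rightarrow> 'a rel \<Rightarrow> 'b set \<Rightarrow> bool" where
  "few_covers F l K \<longleftrightarrow>
     (\<exists>Z. \<exists>w\<in>Field l. (\<forall>i. |Z i| \<le>o |underS l w| ) \<and> (\<forall>x\<in>K. \<forall>\<^sub>F i in F. x \<in> Z i))"

lemma coversI:
  assumes "\<And>i. |Y i| \<le>o l" "\<And>x. x \<in> K \<Longrightarrow> \<forall>\<^sub>F i in F. x \<in> Y i"
  shows "covers F l K"
  unfolding covers_def by (intro exI[of _ Y] conjI allI ballI assms)

lemma few_covers_underSI:
  assumes "w \<in> Field l" "\<And>i. |Z i| \<le>o |underS l w|" "\<And>x. x \<in> K \<Longrightarrow> \<forall>\<^sub>F i in F. x \<in> Z i"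
  shows "few_covers F l K"
  unfolding few_covers_def by (intro exI[of _ Z] bexI[of _ w] conjI allI ballI assms)

lemma card_inj_image_le:
  assumes "inj_on f A" "f ` A \<subseteq> B"
  shows "|A| \<le>o |B|"
  using assms card_of_ordLeq[of A B] by blast

lemma card_vimage_le:
  assumes "inj_on h K"
  shows "|{x \<in> K. h x \<in> Y}| \<le>o |Y|"
proof (rule card_inj_image_le)
  show "inj_on h {x \<in> K. h x \<in> Y}" by (rule inj_on_subset[OF assms]) blast
qed blast

lemma card_leE:
  assumes "|A| \<le>o |B|"
  obtains f where "inj_on f A" "\<And>x. x \<in> A \<Longrightarrow> f x \<in> B"
proof -
  obtain f where "inj_on f A" "f ` A \<subseteq> B" using assms card_of_ordLeq[of A B] by blast
  then show thesis using that[of f] by blast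
qed

lemma covers_le:
  assumes "covers F l K" "|K'| \<le>o |K|"
  shows "covers F l K'"
proof -
  obtain Y where Y: "\<And>i. |Y i| \<le>o l" "\<And>x. x \<in> K \<Longrightarrow> \<forall>\<^sub>F i in F. x \<in> Y i"
    using assms(1) unfolding covers_def by metis
  obtain h where h: "inj_on h K'" "\<And>x. x \<in> K' \<Longrightarrow> h x \<in> K" using card_leE[OF assms(2)] by metis
  have "|{x \<in> K'. h x \<in> Y i}| \<le>o l" for i
    by (rule ordLeq_transitive[OF card_vimage_le[OF h(1)] Y(1)])
  moreover have "\<forall>\<^sub>F i in F. x \<in> {x \<in> K'. h x \<in> Y i}" if "x \<in> K'" for x
    using Y(2)[OF h(2)[OF that]] by eventually_elim (simp add: that)
  ultimately show ?thesis by (rule coversI)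
qed

lemma few_covers_le:
  assumes "few_covers F l K" "|K'| \<le>o |K|"
  shows "few_covers F l K'"
proof -
  obtain Z w where w: "w \<in> Field l"
    and Z: "\<And>i. |Z i| \<le>o |underS l w|" "\<And>x. x \<in> K \<Longrightarrow> \<forall>\<^sub>F i in F. x \<in> Z i"
    using assms(1) unfolding few_covers_def by metis
  obtain h where h: "inj_on h K'" "\<And>x. x \<in> K' \<Longrightarrow> h x \<in> K" using card_leE[OF assms(2)] by metis
  have "|{x \<in> K'. h x \<in> Z i}| \<le>o |underS l w|" for i
    by (rule ordLeq_transitive[OF card_vimage_le[OF h(1)] Z(1)])
  moreover have "\<forall>\<^sub>F i in F. x \<in> {x \<in> K'. h x \<in> Z i}" if "x \<in> K'" for x
    using Z(2)[OF h(2)[OF that]] by eventually_elim (simp add: that)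
  ultimately show ?thesis by (rule few_covers_underSI[OF w])
qed

text \<open>The ultrafilter becomes a filter on the whole index type, so that relations in the
  ultrapower are \<open>eventually\<close> statements; the last assumption is the failure of
  \<open>l\<close>-decomposability.\<close>

locale indecomposable = singular l for l :: "'a rel" +
  fixes F :: "'i filter"
  assumes not_bot: "F \<noteq> bot"
    and dichotomy: "(\<forall>\<^sub>F i in F. P i) \<or> (\<forall>\<^sub>F i in F. \<not> P i)"
    and indecomposable: "(\<And>i. f i \<in> Field l) \<Longrightarrow> \<exists>W\<subseteq>Field l. |W| <o l \<and> (\<forall>\<^sub>F i in F. f i \<in> W)"
begin

lemma not_eventually_iff: "\<not> (\<forall>\<^sub>F i in F. P i) \<longleftrightarrow> (\<forall>\<^sub>F i in F. \<not> P i)"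
proof
  assume "\<forall>\<^sub>F i in F. \<not> P i"
  show "\<not> (\<forall>\<^sub>F i in F. P i)"
  proof
    assume "\<forall>\<^sub>F i in F. P i"
    with \<open>\<forall>\<^sub>F i in F. \<not> P i\<close> have "\<forall>\<^sub>F i in F. False" by eventually_elim simp
    then show False using not_bot by (simp add: eventually_False)
  qed
qed (use dichotomy[of P] in blast)

lemma eventually_witness: "\<forall>\<^sub>F i in F. P i \<Longrightarrow> \<exists>i. P i"
  using not_bot eventually_happens' by metis

lemma small_values:
  assumes "|T| \<le>o l" "\<forall>\<^sub>F i in F. f i \<in> T"
  obtains W where "W \<subseteq> T" "|W| <o l" "\<forall>\<^sub>F i in F. f i \<in> W"
proof -
  have "|T| \<le>o |Field l|" using assms(1) card_le_order[OF card_l] by metis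
  then obtain h where h: "inj_on h T" "\<And>t. t \<in> T \<Longrightarrow> h t \<in> Field l" using card_leE by metis
  \<comment> \<open>A default for the indices with \<open>f i\<close> outside \<open>T\<close>,
    since \<open>indecomposable\<close> wants values in \<open>l\<close> everywhere.\<close>
  obtain z where z: "z \<in> Field l" using infinite_l by fastforce
  have "\<exists>W\<subseteq>Field l. |W| <o l \<and> (\<forall>\<^sub>F i in F. (if f i \<in> T then h (f i) else z) \<in> W)"
    by (rule indecomposable) (simp add: h z)
  then obtain W where W: "|W| <o l" "\<forall>\<^sub>F i in F. (if f i \<in> T then h (f i) else z) \<in> W"
    by blast
  have "|{t \<in> T. h t \<in> W}| \<le>o |W|"
    using card_vimage_le[OF h(1)] .
  then have "|{t \<in> T. h t \<in> W}| <o l" using W(1) by (rule small_le)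
  moreover have "\<forall>\<^sub>F i in F. f i \<in> {t \<in> T. h t \<in> W}"
    using W(2) assms(2) by eventually_elim auto
  ultimately show thesis using that[of "{t \<in> T. h t \<in> W}"] by blast
qed

lemma few_coversI:
  assumes "|B| <o l" "\<forall>\<^sub>F i in F. |Z i| \<le>o |B|" "\<And>x. x \<in> K \<Longrightarrow> \<forall>\<^sub>F i in F. x \<in> Z i"
  shows "few_covers F l K"
proof -
  obtain w where w: "w \<in> Field l" "|B| \<le>o |underS l w|"
    using underS_bound[OF assms(1) assms(1)] by metis
  \<comment> \<open>The size bound must hold at every index, so the cover is emptied at the
    exceptional ones.\<close>
  define Z' where "Z' = (\<lambda>i. if |Z i| \<le>o |B| then Z i else {})"
  have "|Z' i| \<le>o |underS l w|" for i
    using w(2) by (auto simp: Z'_def card_of_empty intro: ordLeq_transitive)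
  moreover have "\<forall>\<^sub>F i in F. x \<in> Z' i" if "x \<in> K" for x
    using assms(2) assms(3)[OF that] by eventually_elim (simp add: Z'_def)
  ultimately show ?thesis by (rule few_covers_underSI[OF w(1)])
qed

text \<open>The finite sets \<open>{x. X x i}\<close> range over a set of cardinality \<open>|l|\<close>.\<close>

lemma not_omega_regular:
  assumes "\<And>x. x \<in> Field l \<Longrightarrow> \<forall>\<^sub>F i in F. X x i" "\<And>i. finite {x \<in> Field l. X x i}"
  shows False
proof -
  let ?T = "{A. A \<subseteq> Field l \<and> finite A}"
  have "|?T| \<le>o l" using card_finite_subsets[OF infinite_l] card_le_order[OF card_l] by metis
  moreover have "\<forall>\<^sub>F i in F. {x \<in> Field l. X x i} \<in> ?T" using assms(2) by auto
  ultimately obtain W where W: "W \<subseteq> ?T" "|W| <o l" "\<forall>\<^sub>F i in F. {x \<in> Field l. X x i} \<in> W"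
    by (rule small_values)
  \<comment> \<open>One infinite cardinal below \<open>l\<close> bounds \<open>|W|\<close> and every
    finite member of \<open>W\<close>. Their union therefore misses some \<open>x\<close>, although
    \<open>x\<close> belongs to almost all of the finite sets.\<close>
  obtain w where w: "w \<in> Field l" "infinite (underS l w)" "|W| \<le>o |underS l w|"
    using underS_bound[OF W(2) W(2)] by metis
  have "|A| \<le>o |underS l w|" if "A \<in> W" for A
  proof -
    have "finite A" using that W(1) by auto
    then have "\<not> |underS l w| \<le>o |A|" using card_of_ordLeq_finite w(2) by metis
    then show ?thesis using card_not_le_iff ordLess_imp_ordLeq by metis
  qed
  then have "|\<Union>A\<in>W. A| \<le>o |underS l w|"
    using w by (intro card_of_UNION_ordLeq_infinite) auto
  then have "|\<Union>A\<in>W. A| <o l" using small_underS[OF w(1)] by (rule ordLeq_ordLess_trans)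
  then have "\<not> Field l \<subseteq> \<Union>W"
    using card_of_mono1[of "Field l" "\<Union>W"] card_less_order[OF card_l] not_ordLess_ordLeq by fastforce
  then obtain x where x: "x \<in> Field l" "x \<notin> \<Union>W" by blast
  have "\<forall>\<^sub>F i in F. False"
    using assms(1)[OF x(1)] W(3) by eventually_elim (use x in blast)
  then show False using not_bot by (simp add: eventually_False)
qed

end

subsection \<open>Least upper bounds modulo the filter\<close>

text \<open>Transfinite recursion for a relation \<open>S\<close> that reads \<open>f\<close> only
  below \<open>e\<close>. A value may exist only if the earlier values are correct, so the recursion
  uses \<open>SOME\<close> unconditionally and correctness follows afterwards by induction.\<close>

lemma wo_choice:
  assumes r: "Well_order r"
    and local: "\<And>e f g y. (\<And>d. d \<in> underS r e \<Longrightarrow> f d = g d) \<Longrightarrow> S e f y \<longleftrightarrow> S e g y"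
    and ex: "\<And>e f. e \<in> Field r \<Longrightarrow> (\<And>d. d \<in> underS r e \<Longrightarrow> S d f (f d)) \<Longrightarrow> \<exists>y. S e f y"
  obtains f where "\<And>e. e \<in> Field r \<Longrightarrow> S e f (f e)"
proof -
  interpret W: wo_rel r using r by (simp add: wo_rel_def)
  define H where "H = (\<lambda>f e. SOME y. S e f y)"
  have "S e f = S e g" if "\<And>d. d \<in> underS r e \<Longrightarrow> f d = g d" for e f g
    by (rule ext, rule local, rule that)
  then have "W.adm_wo H"
    unfolding W.adm_wo_def H_def by (intro allI impI) metis
  then have unfold: "W.worec H = H (W.worec H)" by (rule W.worec_fixpoint)
  have "e \<in> Field r \<longrightarrow> S e (W.worec H) (W.worec H e)" for e
  proof (induction e rule: W.well_order_induct)
    case (1 e)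
    show ?case
    proof
      assume "e \<in> Field r"
      then have "\<exists>y. S e (W.worec H) y"
      proof (rule ex)
        fix d assume "d \<in> underS r e"
        then show "S d (W.worec H) (W.worec H d)"
          using 1 underS_in_Field(1)[of d r e] by (simp add: underS_def)
      qed
      then have "S e (W.worec H) (H (W.worec H) e)" unfolding H_def by (rule someI_ex)
      then show "S e (W.worec H) (W.worec H e)" using unfold by metis
    qed
  qed
  then show thesis using that[of "W.worec H"] by blast
qed

text \<open>The intervals from \<open>start e\<close> up to \<open>nxt (start e)\<close> are made
  pairwise disjoint, so that a point can carry the label \<open>e\<close> of its interval. By
  recursion, \<open>start e\<close> lies beyond the ends of all earlier intervals; these are fewer
  than \<open>r\<close>, so regularity provides such a point.\<close>

lemma disjoint_blocks:
  assumes reg: "regular_cardinal r" and next_in: "\<And>x. x \<in> Field r \<Longrightarrow> nxt x \<in> Field r"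
  shows "\<exists>b start. \<forall>e\<in>Field r. start e \<in> Field r \<and>
    (\<forall>z. (start e, z) \<in> r \<longrightarrow> z \<in> underS r (nxt (start e)) \<longrightarrow> b z = e)"
proof -
  note r = regular_stable[OF reg]
  obtain f where f: "\<And>e. e \<in> Field r \<Longrightarrow> f e \<in> Field r \<and> (\<forall>d\<in>underS r e. (nxt (f d), f e) \<in> r)"
  proof (rule wo_choice[OF r(2), where S = "\<lambda>e f y. y \<in> Field r \<and> (\<forall>d\<in>underS r e. (nxt (f d), y) \<in> r)"])
    fix e f assume e: "e \<in> Field r"
      and f: "\<And>d. d \<in> underS r e \<Longrightarrow> f d \<in> Field r \<and> (\<forall>c\<in>underS r d. (nxt (f c), f d) \<in> r)"
    have "(\<lambda>d. nxt (f d)) ` underS r e \<subseteq> Field r" using f next_in by blast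
    moreover have "|(\<lambda>d. nxt (f d)) ` underS r e| <o r"
      using card_of_underS[OF r(1) e] by (rule ordLeq_ordLess_trans[OF card_of_image])
    ultimately obtain y where y: "y \<in> Field r"
      "\<And>x. x \<in> (\<lambda>d. nxt (f d)) ` underS r e \<Longrightarrow> x \<in> underS r y"
      by (rule stable_small_bounded[OF reg]) blast
    show "\<exists>y. y \<in> Field r \<and> (\<forall>d\<in>underS r e. (nxt (f d), y) \<in> r)"
      by (intro exI[of _ y] conjI ballI y(1)) (rule underS_le, rule y(2), rule imageI)
  qed auto
  define Q where "Q = (\<lambda>z e. e \<in> Field r \<and> (f e, z) \<in> r \<and> z \<in> underS r (nxt (f e)))"
  have no: False if "Q z d" "Q z e" "d \<in> underS r e" for z d e
  proof -
    have "(nxt (f d), z) \<in> r"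
      using wo_trans[OF r(2)] f[of e] that unfolding Q_def by blast
    then show False using wo_not_less[OF r(2)] that(1) unfolding Q_def by blast
  qed
  have "d = e" if "Q z d" "Q z e" for z d e
  proof (rule wo_cases[OF r(2)])
    show "d \<in> Field r" "e \<in> Field r" using that by (auto simp: Q_def)
    show "d = e" if "(d, e) \<in> r"
      using that no[OF \<open>Q z d\<close> \<open>Q z e\<close>] by (auto simp: underS_def)
    show "d = e" if "e \<in> underS r d"
      using that no[OF \<open>Q z e\<close> \<open>Q z d\<close>] by auto
  qed
  then have "(SOME e. Q z e) = e" if "Q z e" for z e
    using that someI[of "Q z" e] by blast
  then have "(SOME e. Q z e) = e"
    if "e \<in> Field r" "(f e, z) \<in> r" "z \<in> underS r (nxt (f e))" for z e
    using that by (simp add: Q_def)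
  then have *: "(SOME e. Q z e) = e"
    if "e \<in> Field r" "(f e, z) \<in> r" "z \<in> underS r (nxt (f e))" for z e
    using that .
  have "f e \<in> Field r" if "e \<in> Field r" for e using f that by blast
  then show ?thesis
    by (intro exI[of _ "\<lambda>z. SOME e. Q z e"] exI[of _ f] ballI conjI allI impI *)
qed

text \<open>In pcf theory this is the projection of \<open>x\<close> to the set
  \<open>insert t A\<close>. The point \<open>t\<close>, later the value of a known upper bound,
  guarantees a candidate when it is above \<open>x\<close> and is the default otherwise.\<close>

definition least_above :: "'b rel \<Rightarrow> 'b \<Rightarrow> 'b \<Rightarrow> 'b set \<Rightarrow> 'b" where
  "least_above r x t A =
     (if (x, t) \<in> r
      then SOME m. m \<in> insert t A \<and> (x, m) \<in> r \<and> (\<forall>z\<in>insert t A. (x, z) \<in> r \<longrightarrow> (m, z) \<in> r)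
      else t)"

lemma least_above:
  assumes r: "Well_order r" and A: "insert t A \<subseteq> Field r"
  shows "least_above r x t A \<in> insert t A"
    and "(x, t) \<in> r \<Longrightarrow> (x, least_above r x t A) \<in> r"
    and "(x, t) \<in> r \<Longrightarrow> z \<in> insert t A \<Longrightarrow> (x, z) \<in> r \<Longrightarrow> (least_above r x t A, z) \<in> r"
proof -
  let ?P = "\<lambda>m. m \<in> insert t A \<and> (x, m) \<in> r \<and> (\<forall>z\<in>insert t A. (x, z) \<in> r \<longrightarrow> (m, z) \<in> r)"
  have *: "?P (least_above r x t A)" if "(x, t) \<in> r"
  proof -
    have "{z \<in> insert t A. (x, z) \<in> r} \<subseteq> Field r" "{z \<in> insert t A. (x, z) \<in> r} \<noteq> {}"
      using A that by auto
    then obtain m where "m \<in> {z \<in> insert t A. (x, z) \<in> r}"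
        "\<And>a. a \<in> {z \<in> insert t A. (x, z) \<in> r} \<Longrightarrow> (m, a) \<in> r"
      by (rule wo_least[OF r]) blast
    then have "?P m" by blast
    then have "?P (SOME m. ?P m)" by (rule someI)
    then show ?thesis using that by (simp add: least_above_def)
  qed
  show "least_above r x t A \<in> insert t A"
    using * by (cases "(x, t) \<in> r") (auto simp: least_above_def)
  show "(x, t) \<in> r \<Longrightarrow> (x, least_above r x t A) \<in> r" using * by blast
  show "(x, t) \<in> r \<Longrightarrow> z \<in> insert t A \<Longrightarrow> (x, z) \<in> r \<Longrightarrow> (least_above r x t A, z) \<in> r"
    using * by blast
qed

context indecomposable
begin

text \<open>If \<open>S i\<close> almost always has a point between \<open>x\<close> and a later
  constant, it almost always meets each of the disjoint intervals of \<open>disjoint_blocks\<close>;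
  the labels of its points then cover \<open>r\<close>.\<close>

lemma interleaved_map:
  assumes reg: "regular_cardinal r"
    and S: "\<And>x. x \<in> Field r \<Longrightarrow> \<exists>y\<in>Field r. \<forall>\<^sub>F i in F. \<exists>z\<in>S i. (x, z) \<in> r \<and> z \<in> underS r y"
  shows "\<exists>b. \<forall>e\<in>Field r. \<forall>\<^sub>F i in F. \<exists>z\<in>S i. b z = e"
proof -
  define nxt where "nxt = (\<lambda>x. SOME y. y \<in> Field r \<and>
    (\<forall>\<^sub>F i in F. \<exists>z\<in>S i. (x, z) \<in> r \<and> z \<in> underS r y))"
  have nxt: "nxt x \<in> Field r \<and> (\<forall>\<^sub>F i in F. \<exists>z\<in>S i. (x, z) \<in> r \<and> z \<in> underS r (nxt x))"
    if "x \<in> Field r" for x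
    unfolding nxt_def by (rule someI_ex) (use S[OF that] in \<open>unfold Bex_def\<close>)
  have "\<exists>b start. \<forall>e\<in>Field r. start e \<in> Field r \<and>
    (\<forall>z. (start e, z) \<in> r \<longrightarrow> z \<in> underS r (nxt (start e)) \<longrightarrow> b z = e)"
    by (rule disjoint_blocks[OF reg]) (use nxt in blast)
  then obtain b start where b: "\<forall>e\<in>Field r. start e \<in> Field r \<and>
    (\<forall>z. (start e, z) \<in> r \<longrightarrow> z \<in> underS r (nxt (start e)) \<longrightarrow> b z = e)"
    by (elim exE) (rule that)
  have "\<forall>\<^sub>F i in F. \<exists>z\<in>S i. b z = e" if e: "e \<in> Field r" for e
  proof -
    have "start e \<in> Field r" using b e by blast
    from conjunct2[OF nxt[OF this]] show ?thesis by eventually_elim (use b e in blast)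
  qed
  then show ?thesis by blast
qed

text \<open>Used contrapositively: if \<open>r\<close> has no cover by small sets, then a family of
  small sets cannot interleave with the constant functions.\<close>

lemma interleaved_few_covers:
  assumes reg: "regular_cardinal r"
    and S: "\<And>x. x \<in> Field r \<Longrightarrow> \<exists>y\<in>Field r. \<forall>\<^sub>F i in F. \<exists>z\<in>S i. (x, z) \<in> r \<and> z \<in> underS r y"
    and B: "|B| <o l" "\<forall>\<^sub>F i in F. |S i| \<le>o |B|"
  shows "few_covers F l (Field r)"
proof -
  have "\<exists>b. \<forall>e\<in>Field r. \<forall>\<^sub>F i in F. \<exists>z\<in>S i. b z = e"
    by (rule interleaved_map[OF reg]) (rule S)
  then obtain b where b: "\<forall>e\<in>Field r. \<forall>\<^sub>F i in F. \<exists>z\<in>S i. b z = e"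
    by (elim exE) (rule that)
  show ?thesis
  proof (rule few_coversI[OF B(1)])
    show "\<forall>\<^sub>F i in F. |b ` S i| \<le>o |B|"
      using B(2) by eventually_elim (rule ordLeq_transitive[OF card_of_image])
    show "\<forall>\<^sub>F i in F. e \<in> b ` S i" if "e \<in> Field r" for e
      using b[rule_format, OF that] by eventually_elim blast
  qed
qed

lemma covers_upper_bound:
  assumes reg: "regular_cardinal r" and "l <o r" and "covers F l (Field r)"
  obtains g where "\<And>i. g i \<in> Field r" "\<And>x. x \<in> Field r \<Longrightarrow> \<forall>\<^sub>F i in F. (x, g i) \<in> r"
proof -
  obtain Y where Y: "\<And>i. |Y i| \<le>o l" "\<And>x. x \<in> Field r \<Longrightarrow> \<forall>\<^sub>F i in F. x \<in> Y i"
    using assms(3) unfolding covers_def by metis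
  define g where "g = (\<lambda>i. SOME y. y \<in> Field r \<and> (\<forall>x\<in>Y i \<inter> Field r. x \<in> underS r y))"
  have "\<exists>y. y \<in> Field r \<and> (\<forall>x\<in>Y i \<inter> Field r. x \<in> underS r y)" for i
  proof -
    have "|Y i \<inter> Field r| \<le>o l" using Y(1) card_of_mono1[of "Y i \<inter> Field r" "Y i"] ordLeq_transitive by blast
    then have "|Y i \<inter> Field r| <o r" using assms(2) by (rule ordLeq_ordLess_trans)
    with Int_lower2 obtain y where "y \<in> Field r" "\<And>x. x \<in> Y i \<inter> Field r \<Longrightarrow> x \<in> underS r y"
      by (rule stable_small_bounded[OF reg]) blast
    then show ?thesis by blast
  qed
  then have g': "g i \<in> Field r \<and> (\<forall>x\<in>Y i \<inter> Field r. x \<in> underS r (g i))" for i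
    unfolding g_def by (rule someI_ex)
  then have g: "g i \<in> Field r" "x \<in> Y i \<inter> Field r \<Longrightarrow> x \<in> underS r (g i)" for i x
    by blast+
  have "\<forall>\<^sub>F i in F. (x, g i) \<in> r" if "x \<in> Field r" for x
    using Y(2)[OF that] by eventually_elim (rule underS_le, rule g(2), use that in simp)
  with g(1) show thesis by (rule that)
qed

text \<open>If there were no least upper bound, transfinite recursion along \<open>l\<close> would produce upper
  bounds \<open>G c\<close>, each below the step function \<open>least_above\<close> determined by the previous ones.  One
  argument \<open>x'\<close> of the step functions serves for all \<open>c\<close>, so at every single index the relevant
  values \<open>G c\<close> descend strictly: this is \<open>(\<omega>, l)\<close>-regularity.\<close>

lemma least_upper_bound:
  assumes reg: "regular_cardinal r" and less: "l <o r" and cov: "covers F l (Field r)"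
    and nfew: "\<not> few_covers F l (Field r)"
  shows "\<exists>p. (\<forall>i. p i \<in> Field r) \<and> (\<forall>x\<in>Field r. \<forall>\<^sub>F i in F. (x, p i) \<in> r) \<and>
    (\<forall>g. (\<forall>i. g i \<in> Field r) \<longrightarrow> (\<forall>\<^sub>F i in F. g i \<in> underS r (p i)) \<longrightarrow>
      (\<exists>x\<in>Field r. \<forall>\<^sub>F i in F. g i \<in> underS r x))"
proof (rule ccontr)
  note r = regular_stable[OF reg]
  define ub where "ub = (\<lambda>g. (\<forall>i. g i \<in> Field r) \<and> (\<forall>x\<in>Field r. \<forall>\<^sub>F i in F. (x, g i) \<in> r))"
  have ubD: "g i \<in> Field r" "x \<in> Field r \<Longrightarrow> \<forall>\<^sub>F i in F. (x, g i) \<in> r" if "ub g" for g i x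
    using that by (auto simp: ub_def)
  assume not_thesis: "\<not> ?thesis"
  have smaller: "\<exists>h. ub h \<and> (\<forall>\<^sub>F i in F. h i \<in> underS r (g i))" if "ub g" for g
  proof (rule ccontr)
    assume *: "\<not> ?thesis"
    show False
    proof (rule notE[OF not_thesis], intro exI[of _ g] conjI allI ballI impI)
      show "g i \<in> Field r" for i using ubD(1)[OF \<open>ub g\<close>] .
      show "\<forall>\<^sub>F i in F. (x, g i) \<in> r" if "x \<in> Field r" for x using ubD(2)[OF \<open>ub g\<close> that] .
      fix h assume h: "\<forall>i. h i \<in> Field r" "\<forall>\<^sub>F i in F. h i \<in> underS r (g i)"
      then have "\<not> ub h" using * by blast
      then obtain x where x: "x \<in> Field r" "\<not> (\<forall>\<^sub>F i in F. (x, h i) \<in> r)"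
        using h(1) by (auto simp: ub_def)
      \<comment> \<open>By the dichotomy, a function that fails to bound a constant lies below it.
        Hence leastness can be stated as: everything below the bound is below a constant.\<close>
      then have "\<forall>\<^sub>F i in F. (x, h i) \<notin> r" using not_eventually_iff[of "\<lambda>i. (x, h i) \<in> r"] by blast
      then have "\<forall>\<^sub>F i in F. h i \<in> underS r x"
        by eventually_elim (use wo_not_le_iff[OF r(2) x(1) spec[OF h(1)]] in blast)
      with x(1) show "\<exists>x\<in>Field r. \<forall>\<^sub>F i in F. h i \<in> underS r x" by blast
    qed
  qed
  obtain t where t: "ub t"
    using covers_upper_bound[OF reg less cov] unfolding ub_def by metis
  define step where "step = (\<lambda>x c G i. least_above r x (t i) ((\<lambda>d. G d i) ` underS l c))"
  obtain G where G: "\<And>c. c \<in> Field l \<Longrightarrow>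
      ub (G c) \<and> (\<exists>x\<in>Field r. \<forall>\<^sub>F i in F. G c i \<in> underS r (step x c G i))"
  proof (rule wo_choice[OF wo_l, where
        S = "\<lambda>c G g. ub g \<and> (\<exists>x\<in>Field r. \<forall>\<^sub>F i in F. g i \<in> underS r (step x c G i))"])
    show "(ub g \<and> (\<exists>x\<in>Field r. \<forall>\<^sub>F i in F. g i \<in> underS r (step x c G i))) \<longleftrightarrow>
        (ub g \<and> (\<exists>x\<in>Field r. \<forall>\<^sub>F i in F. g i \<in> underS r (step x c G' i)))"
      if "\<And>d. d \<in> underS l c \<Longrightarrow> G d = G' d" for c G G' g
    proof -
      have "(\<lambda>d. G d i) ` underS l c = (\<lambda>d. G' d i) ` underS l c" for i
        using that by (intro image_cong) auto
      then show ?thesis by (simp add: step_def)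
    qed
  next
    fix c G assume c: "c \<in> Field l"
      and G: "\<And>d. d \<in> underS l c \<Longrightarrow> ub (G d) \<and> (\<exists>x\<in>Field r. \<forall>\<^sub>F i in F. G d i \<in> underS r (step x d G i))"
    define T where "T = (\<lambda>i. insert (t i) ((\<lambda>d. G d i) ` underS l c))"
    define B where "B = {None} \<union> Some ` underS l c"
    have B: "|B| <o l"
      unfolding B_def by (intro small_Un small_image small_underS c small_finite) simp
    have TB: "|T i| \<le>o |B|" for i
    proof -
      have "T i = (\<lambda>d. case d of None \<Rightarrow> t i | Some d \<Rightarrow> G d i) ` B"
        by (auto simp: T_def B_def image_Un image_image)
      then show ?thesis using card_of_image by metis
    qed
    \<comment> \<open>The few values collected so far do not interleave with the constants. So for
      some \<open>x\<close> and every \<open>y\<close> they almost always avoid the interval from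
      \<open>x\<close> to \<open>y\<close>, and the least of them above \<open>x\<close> is again an
      upper bound.\<close>
    have "\<not> (\<forall>x\<in>Field r. \<exists>y\<in>Field r. \<forall>\<^sub>F i in F. \<exists>z\<in>T i. (x, z) \<in> r \<and> z \<in> underS r y)"
    proof
      assume "\<forall>x\<in>Field r. \<exists>y\<in>Field r. \<forall>\<^sub>F i in F. \<exists>z\<in>T i. (x, z) \<in> r \<and> z \<in> underS r y"
      then have "few_covers F l (Field r)"
        by (intro interleaved_few_covers[OF reg _ B, of T]) (simp_all add: TB)
      with nfew show False ..
    qed
    then have "\<exists>x\<in>Field r. \<forall>y\<in>Field r. \<not> (\<forall>\<^sub>F i in F. \<exists>z\<in>T i. (x, z) \<in> r \<and> z \<in> underS r y)"
      by simp
    then obtain x where x: "x \<in> Field r"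
      "\<forall>y\<in>Field r. \<not> (\<forall>\<^sub>F i in F. \<exists>z\<in>T i. (x, z) \<in> r \<and> z \<in> underS r y)"
      by (elim bexE) (rule that)
    have x2: "\<forall>\<^sub>F i in F. \<not> (\<exists>z\<in>T i. (x, z) \<in> r \<and> z \<in> underS r y)" if "y \<in> Field r" for y
      by (rule not_eventually_iff[THEN iffD1, OF bspec[OF x(2) that]])
    have TF: "T i \<subseteq> Field r" for i using ubD(1) t G by (auto simp: T_def)
    have step: "step x c G i \<in> T i" "(x, t i) \<in> r \<Longrightarrow> (x, step x c G i) \<in> r" for i
      using least_above(1,2)[OF r(2)] TF[of i] unfolding step_def T_def by blast+
    have "ub (step x c G)"
      unfolding ub_def
    proof (intro conjI allI ballI)
      show "step x c G i \<in> Field r" for i using step(1) TF by blast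
      fix y assume y: "y \<in> Field r"
      show "\<forall>\<^sub>F i in F. (y, step x c G i) \<in> r"
        using x2[OF y] ubD(2)[OF t x(1)]
      proof eventually_elim
        case (elim i)
        then have "step x c G i \<notin> underS r y" using step by blast
        then show ?case using wo_not_le_iff[OF r(2) y, of "step x c G i"] step(1) TF by blast
      qed
    qed
    then show "\<exists>g. ub g \<and> (\<exists>x\<in>Field r. \<forall>\<^sub>F i in F. g i \<in> underS r (step x c G i))"
      using smaller x(1) by blast
  qed blast
  then have Gub: "ub (G c)" if "c \<in> Field l" for c using that by blast
  obtain X where X: "\<And>c. c \<in> Field l \<Longrightarrow> X c \<in> Field r"
    "\<And>c. c \<in> Field l \<Longrightarrow> \<forall>\<^sub>F i in F. G c i \<in> underS r (step (X c) c G i)"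
    using G by metis
  have "X ` Field l \<subseteq> Field r" using X(1) by blast
  moreover have "|X ` Field l| <o r"
    using card_of_image order_less_card[OF card_l] less ordLeq_ordLess_trans by metis
  ultimately obtain x' where x': "x' \<in> Field r" "\<And>x. x \<in> X ` Field l \<Longrightarrow> x \<in> underS r x'"
    by (rule stable_small_bounded[OF reg]) blast
  have GF: "insert (t i) ((\<lambda>d. G d i) ` underS l c) \<subseteq> Field r" for i c
    using ubD(1) t Gub underS_in_Field(1) by fast
  \<comment> \<open>Since \<open>least_above\<close> grows with \<open>x\<close>, the strict
    inequality for \<open>X c\<close> persists for the common argument \<open>x'\<close>. The other
    two conditions make \<open>G d i\<close> a candidate in the minimum for any later
    \<open>c\<close>, whence the descent.\<close>
  define Q where "Q = (\<lambda>c i. (x', t i) \<in> r \<and> (x', G c i) \<in> r \<and> G c i \<in> underS r (step x' c G i))"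
  have "\<forall>\<^sub>F i in F. Q c i" if c: "c \<in> Field l" for c
    using X(2)[OF c] ubD(2)[OF Gub[OF c] x'(1)] ubD(2)[OF t x'(1)]
  proof eventually_elim
    case (elim i)
    have xx: "(X c, x') \<in> r" by (rule underS_le, rule x'(2), rule imageI, rule c)
    have "(x', step x' c G i) \<in> r"
      unfolding step_def by (rule least_above(2)[OF r(2) GF elim(3)])
    then have *: "(X c, step x' c G i) \<in> r" by (rule wo_trans[OF r(2) xx])
    have xt: "(X c, t i) \<in> r" by (rule wo_trans[OF r(2) xx elim(3)])
    have "(step (X c) c G i, step x' c G i) \<in> r"
      using least_above(3)[OF r(2) GF xt least_above(1)[OF r(2) GF], of x' c] * by (simp add: step_def)
    then have "G c i \<in> underS r (step x' c G i)" by (rule wo_less_le_trans[OF r(2) elim(1)])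
    then show ?case using elim by (simp add: Q_def)
  qed
  moreover have "finite {c \<in> Field l. Q c i}" for i
  proof (rule finite_decreasing[OF wo_l r(2), where g = "\<lambda>c. G c i"])
    fix d c assume *: "d \<in> {c \<in> Field l. Q c i}" "c \<in> {c \<in> Field l. Q c i}" "d \<in> underS l c"
    have "(step x' c G i, G d i) \<in> r"
      unfolding step_def using *
      by (intro least_above(3)[OF r(2) GF]) (auto simp: Q_def)
    moreover have "G c i \<in> underS r (step x' c G i)" using * by (simp add: Q_def)
    ultimately show "G c i \<in> underS r (G d i)" using wo_less_le_trans[OF r(2)] by simp
  qed blast
  ultimately show False by (rule not_omega_regular)
qed

end

section \<open>Cofinal subsets of initial segments\<close>

definition cofinal_below :: "'b rel \<Rightarrow> 'b \<Rightarrow> 'b set \<Rightarrow> bool" where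
  "cofinal_below r p C \<longleftrightarrow> C \<subseteq> underS r p \<and> (\<forall>y\<in>underS r p. \<exists>z\<in>C. (y, z) \<in> r)"

text \<open>\<open>|C|\<close> is the cofinality of the ordinal \<open>p\<close>; it is 1 for a
  successor, as domination is not strict.\<close>

definition shortest_cofinal :: "'b rel \<Rightarrow> 'b \<Rightarrow> 'b set \<Rightarrow> bool" where
  "shortest_cofinal r p C \<longleftrightarrow> cofinal_below r p C \<and> (\<forall>B. cofinal_below r p B \<longrightarrow> |C| \<le>o |B| )"

lemma ex_shortest_cofinal:
  assumes "Well_order r"
  shows "\<exists>C. shortest_cofinal r p C"
proof -
  let ?R = "{|C| | C. cofinal_below r p C}"
  have "cofinal_below r p (underS r p)"
    using wo_refl[OF assms underS_in_Field(1)] by (auto simp: cofinal_below_def)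
  then have "?R \<noteq> {}" by blast
  moreover have "\<forall>c\<in>?R. Card_order c" using card_of_Card_order by blast
  ultimately have "\<exists>c\<in>?R. \<forall>d\<in>?R. c \<le>o d" by (rule exists_minim_Card_order)
  then show ?thesis unfolding shortest_cofinal_def by blast
qed

lemma shortest_cofinalD:
  assumes "shortest_cofinal r p C"
  shows "C \<subseteq> underS r p" "y \<in> underS r p \<Longrightarrow> \<exists>z\<in>C. (y, z) \<in> r" "cofinal_below r p B \<Longrightarrow> |C| \<le>o |B|"
  using assms by (auto simp: shortest_cofinal_def cofinal_below_def)

lemma shortest_cofinal_bounded:
  assumes r: "Well_order r" and C: "shortest_cofinal r p C"
    and A: "A \<subseteq> underS r p" "|A| <o |C|"
  obtains q where "q \<in> underS r p" "\<And>z. z \<in> A \<Longrightarrow> (z, q) \<in> r"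
proof -
  have "\<not> cofinal_below r p A"
    using shortest_cofinalD(3)[OF C, of A] A(2) not_ordLess_ordLeq by blast
  then obtain q where q: "q \<in> underS r p" "\<And>z. z \<in> A \<Longrightarrow> (q, z) \<notin> r"
    using A(1) by (auto simp: cofinal_below_def)
  have "(z, q) \<in> r" if "z \<in> A" for z
  proof -
    have "z \<in> Field r" "q \<in> Field r" using that A(1) q(1) underS_in_Field(1)[of _ r p] by blast+
    then show ?thesis using wo_not_le_iff[OF r, of q z] q(2)[OF that] underS_le[of z r q] by blast
  qed
  with q(1) show thesis by (rule that)
qed

text \<open>If \<open>|C|\<close> were \<open>|l|\<close>, a short cofinal subset \<open>E\<close>
  of \<open>l\<close> would split \<open>C\<close> into \<open>|E|\<close> pieces of size below
  \<open>|l|\<close>. Each piece is bounded by minimality of \<open>C\<close>, and the bounds form a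
  cofinal set of size at most \<open>|E|\<close>.\<close>

lemma (in singular) shortest_cofinal_small:
  assumes r: "Well_order r" and C: "shortest_cofinal r p C" and le: "|C| \<le>o l"
  shows "|C| <o l"
proof (rule ccontr)
  assume "\<not> |C| <o l"
  then have lC: "l \<le>o |C|" using not_card_less_order[OF card_l] by blast
  have "|C| \<le>o |Field l|" using le card_le_order[OF card_l] by blast
  then obtain h where h: "inj_on h C" "\<And>z. z \<in> C \<Longrightarrow> h z \<in> Field l" by (rule card_leE) blast
  obtain E where E: "E \<subseteq> Field l" "cofinal E l" "|E| <o l" by (rule short_cofinal)
  define A where "A = (\<lambda>e. {z \<in> C. h z \<in> underS l e})"
  have "\<exists>q. q \<in> underS r p \<and> (\<forall>z\<in>A e. (z, q) \<in> r)" if "e \<in> E" for e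
  proof -
    have e: "e \<in> Field l" using that E(1) by blast
    have "|A e| \<le>o |underS l e|" unfolding A_def by (rule card_vimage_le[OF h(1)])
    then have "|A e| <o l" using small_underS[OF e] by (rule small_le)
    then have "|A e| <o |C|" using lC by (rule ordLess_ordLeq_trans)
    moreover have "A e \<subseteq> underS r p" using shortest_cofinalD(1)[OF C] by (auto simp: A_def)
    ultimately obtain q where "q \<in> underS r p" "\<And>z. z \<in> A e \<Longrightarrow> (z, q) \<in> r"
      using shortest_cofinal_bounded[OF r C] by blast
    then show ?thesis by blast
  qed
  then obtain q where q: "\<And>e. e \<in> E \<Longrightarrow> q e \<in> underS r p"
    "\<And>e z. e \<in> E \<Longrightarrow> z \<in> A e \<Longrightarrow> (z, q e) \<in> r"
    by metis
  have "cofinal_below r p (q ` E)"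
    unfolding cofinal_below_def
  proof (intro conjI ballI)
    show "q ` E \<subseteq> underS r p" using q(1) by blast
    fix y assume "y \<in> underS r p"
    then obtain z where z: "z \<in> C" "(y, z) \<in> r" using shortest_cofinalD(2)[OF C] by blast
    obtain e where e: "e \<in> E" "h z \<noteq> e" "(h z, e) \<in> l"
      using E(2) h(2)[OF z(1)] unfolding cofinal_def by blast
    then have "(z, q e) \<in> r" using q(2)[OF e(1)] z(1) by (simp add: A_def underS_def)
    then show "\<exists>z\<in>q ` E. (y, z) \<in> r" using wo_trans[OF r z(2)] e(1) by blast
  qed
  then have "|C| \<le>o |q ` E|" by (rule shortest_cofinalD(3)[OF C])
  then have "|C| \<le>o |E|" using card_of_image ordLeq_transitive by blast
  then have "l \<le>o |E|" using lC ordLeq_transitive by blast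
  then show False using E(3) not_ordLess_ordLeq by blast
qed

section \<open>The ladder: cofinal sets below the least upper bound\<close>

locale uncovered = indecomposable l F for l :: "'a rel" and F :: "'i filter" +
  fixes r :: "'b rel"
  assumes reg: "regular_cardinal r" and less: "l <o r"
    and cov: "covers F l (Field r)" and not_few: "\<not> few_covers F l (Field r)"
begin

lemmas card_r = regular_stable(1)[OF reg] and wo_r = regular_stable(2)[OF reg]
  and infinite_r = regular_stable(3)[OF reg]

definition lub :: "'i \<Rightarrow> 'b" where
  "lub = (SOME p. (\<forall>i. p i \<in> Field r) \<and> (\<forall>x\<in>Field r. \<forall>\<^sub>F i in F. (x, p i) \<in> r) \<and>
    (\<forall>g. (\<forall>i. g i \<in> Field r) \<longrightarrow> (\<forall>\<^sub>F i in F. g i \<in> underS r (p i)) \<longrightarrow>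
      (\<exists>x\<in>Field r. \<forall>\<^sub>F i in F. g i \<in> underS r x)))"

lemma lub_props:
  "(\<forall>i. lub i \<in> Field r) \<and> (\<forall>x\<in>Field r. \<forall>\<^sub>F i in F. (x, lub i) \<in> r) \<and>
    (\<forall>g. (\<forall>i. g i \<in> Field r) \<longrightarrow> (\<forall>\<^sub>F i in F. g i \<in> underS r (lub i)) \<longrightarrow>
      (\<exists>x\<in>Field r. \<forall>\<^sub>F i in F. g i \<in> underS r x))"
  using someI_ex[OF least_upper_bound[OF reg less cov not_few]] unfolding lub_def .

lemma lub_in: "lub i \<in> Field r"
  using lub_props by simp

lemma below_lub:
  assumes "x \<in> Field r"
  shows "\<forall>\<^sub>F i in F. x \<in> underS r (lub i)"
proof -
  obtain y where y: "y \<in> Field r" "x \<in> underS r y"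
    by (rule infinite_no_max[OF card_r infinite_r assms])
  have "\<forall>\<^sub>F i in F. (y, lub i) \<in> r" using lub_props y(1) by simp
  then show ?thesis by eventually_elim (rule wo_less_le_trans[OF wo_r y(2)])
qed

lemma lub_least:
  assumes "\<forall>\<^sub>F i in F. g i \<in> underS r (lub i)"
  obtains x where "x \<in> Field r" "\<forall>\<^sub>F i in F. g i \<in> underS r x"
proof -
  \<comment> \<open>\<open>lub_props\<close> wants values in \<open>r\<close> at all indices; the
    default is used only on a null set.\<close>
  define g' where "g' = (\<lambda>i. if g i \<in> underS r (lub i) then g i else lub i)"
  have 1: "\<forall>i. g' i \<in> Field r" using lub_in underS_in_Field(1) by (auto simp: g'_def)
  have 2: "\<forall>\<^sub>F i in F. g' i \<in> underS r (lub i)" using assms by eventually_elim (simp add: g'_def)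
  have "\<exists>x\<in>Field r. \<forall>\<^sub>F i in F. g' i \<in> underS r x" using lub_props 1 2 by simp
  then obtain x where x: "x \<in> Field r" "\<forall>\<^sub>F i in F. g' i \<in> underS r x" by (elim bexE) (rule that)
  have "\<forall>\<^sub>F i in F. g i \<in> underS r x" using x(2) assms by eventually_elim (simp add: g'_def)
  with x(1) show thesis by (rule that)
qed

definition ladder :: "'i \<Rightarrow> 'b set" where
  "ladder i = (SOME C. shortest_cofinal r (lub i) C)"

lemma ladder: "shortest_cofinal r (lub i) (ladder i)"
  unfolding ladder_def by (rule someI_ex) (rule ex_shortest_cofinal[OF wo_r])

lemmas ladder_below = shortest_cofinalD(1)[OF ladder] and ladder_cofinal = shortest_cofinalD(2)[OF ladder]

text \<open>A set with fewer elements than the ladder has a bound \<open>q i\<close> below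
  \<open>lub i\<close>. The function \<open>q\<close> is then below a constant, so one constant
  bounds the sets at almost all indices.\<close>

lemma ladder_bounded:
  assumes "\<forall>\<^sub>F i in F. A i \<subseteq> underS r (lub i) \<and> |A i| <o |ladder i|"
  obtains x where "x \<in> Field r" "\<forall>\<^sub>F i in F. \<forall>z\<in>A i. z \<in> underS r x"
proof -
  define q where "q = (\<lambda>i. SOME q. q \<in> underS r (lub i) \<and> (\<forall>z\<in>A i. (z, q) \<in> r))"
  have q: "\<forall>\<^sub>F i in F. q i \<in> underS r (lub i) \<and> (\<forall>z\<in>A i. (z, q i) \<in> r)"
    using assms
  proof eventually_elim
    case (elim i)
    then obtain q where "q \<in> underS r (lub i)" "\<And>z. z \<in> A i \<Longrightarrow> (z, q) \<in> r"
      using shortest_cofinal_bounded[OF wo_r ladder] by blast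
    then have "\<exists>q. q \<in> underS r (lub i) \<and> (\<forall>z\<in>A i. (z, q) \<in> r)" by blast
    then show ?case unfolding q_def by (rule someI_ex)
  qed
  then have "\<forall>\<^sub>F i in F. q i \<in> underS r (lub i)" by eventually_elim simp
  then obtain x where x: "x \<in> Field r" "\<forall>\<^sub>F i in F. q i \<in> underS r x" by (rule lub_least)
  have "\<forall>\<^sub>F i in F. \<forall>z\<in>A i. z \<in> underS r x"
    using q x(2)
  proof eventually_elim
    case (elim i)
    then show ?case using wo_le_less_trans[OF wo_r] by blast
  qed
  with x(1) show thesis by (rule that)
qed

text \<open>If the cover \<open>Y i\<close> were not cofinal below \<open>lub i\<close>, there would
  be points \<open>q i\<close> that no member of \<open>Y i\<close> below \<open>lub i\<close>
  reaches. By leastness some constant \<open>x\<close> is above \<open>q\<close>, yet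
  \<open>x\<close> itself almost always lies in \<open>Y i\<close>. So the ladder has size at most
  \<open>|l|\<close>, and less because \<open>l\<close> is singular.\<close>

lemma ladder_small: "\<forall>\<^sub>F i in F. |ladder i| <o l"
proof -
  obtain Y where Y: "\<And>i. |Y i| \<le>o l" "\<And>x. x \<in> Field r \<Longrightarrow> \<forall>\<^sub>F i in F. x \<in> Y i"
    using cov unfolding covers_def by blast
  have "\<forall>\<^sub>F i in F. cofinal_below r (lub i) (Y i \<inter> underS r (lub i))"
  proof (rule ccontr)
    define q where "q = (\<lambda>i. SOME q. q \<in> underS r (lub i) \<and> (\<forall>z\<in>Y i \<inter> underS r (lub i). (q, z) \<notin> r))"
    assume "\<not> ?thesis"
    then have "\<forall>\<^sub>F i in F. \<not> cofinal_below r (lub i) (Y i \<inter> underS r (lub i))"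
      using not_eventually_iff[of "\<lambda>i. cofinal_below r (lub i) (Y i \<inter> underS r (lub i))"] by blast
    then have q: "\<forall>\<^sub>F i in F. q i \<in> underS r (lub i) \<and> (\<forall>z\<in>Y i \<inter> underS r (lub i). (q i, z) \<notin> r)"
    proof eventually_elim
      case (elim i)
      then have "\<exists>q. q \<in> underS r (lub i) \<and> (\<forall>z\<in>Y i \<inter> underS r (lub i). (q, z) \<notin> r)"
        by (auto simp: cofinal_below_def)
      then show ?case unfolding q_def by (rule someI_ex)
    qed
    then have "\<forall>\<^sub>F i in F. q i \<in> underS r (lub i)" by eventually_elim simp
    then obtain x where x: "x \<in> Field r" "\<forall>\<^sub>F i in F. q i \<in> underS r x" by (rule lub_least)
    have "\<forall>\<^sub>F i in F. False"
      using q x(2) Y(2)[OF x(1)] below_lub[OF x(1)]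
    proof eventually_elim
      case (elim i)
      then show False using underS_le[of "q i" r x] by simp
    qed
    then show False using not_bot by (simp add: eventually_False)
  qed
  then show ?thesis
  proof eventually_elim
    case (elim i)
    have "|ladder i| \<le>o |Y i \<inter> underS r (lub i)|"
      by (rule shortest_cofinalD(3)[OF ladder elim])
    also have "|Y i \<inter> underS r (lub i)| \<le>o |Y i|" by (rule card_of_mono1) simp
    also note Y(1)[of i]
    finally show ?case by (rule shortest_cofinal_small[OF wo_r ladder])
  qed
qed

text \<open>Choosing a ladder point above \<open>x\<close> at each index gives a function below
  \<open>lub\<close>, and a constant bounds it.\<close>

lemma ladder_interleaved:
  assumes x: "x \<in> Field r"
  shows "\<exists>y\<in>Field r. \<forall>\<^sub>F i in F. \<exists>z\<in>ladder i. (x, z) \<in> r \<and> z \<in> underS r y"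
proof -
  define q where "q = (\<lambda>i. SOME z. z \<in> ladder i \<and> (x, z) \<in> r)"
  have q: "\<forall>\<^sub>F i in F. q i \<in> ladder i \<and> (x, q i) \<in> r"
    using below_lub[OF x]
  proof eventually_elim
    case (elim i)
    then have "\<exists>z. z \<in> ladder i \<and> (x, z) \<in> r" using ladder_cofinal by blast
    then show ?case unfolding q_def by (rule someI_ex)
  qed
  then have "\<forall>\<^sub>F i in F. q i \<in> underS r (lub i)"
    by eventually_elim (use ladder_below in blast)
  then obtain y where y: "y \<in> Field r" "\<forall>\<^sub>F i in F. q i \<in> underS r y" by (rule lub_least)
  have "\<forall>\<^sub>F i in F. \<exists>z\<in>ladder i. (x, z) \<in> r \<and> z \<in> underS r y"
    using q y(2) by eventually_elim blast
  with y(1) show ?thesis by (rule bexI[rotated])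
qed

text \<open>The ladder interleaves with the constants, so a ladder of size at most
  \<open>|B|\<close> at almost all indices would yield a small cover of \<open>r\<close>.\<close>

lemma ladder_large:
  assumes "|B| <o l"
  shows "\<forall>\<^sub>F i in F. |B| <o |ladder i|"
proof (rule ccontr)
  assume "\<not> ?thesis"
  then have "\<forall>\<^sub>F i in F. \<not> |B| <o |ladder i|" using not_eventually_iff[of "\<lambda>i. |B| <o |ladder i|"] by blast
  then have "\<forall>\<^sub>F i in F. |ladder i| \<le>o |B|"
    by eventually_elim (use card_not_le_iff in blast)
  then have "few_covers F l (Field r)"
    by (intro interleaved_few_covers[OF reg _ assms, of ladder] ladder_interleaved)
  with not_few show False ..
qed

lemma ladder_map: "\<exists>b. \<forall>e\<in>Field r. \<forall>\<^sub>F i in F. \<exists>z\<in>ladder i. b z = e"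
  by (rule interleaved_map[OF reg ladder_interleaved])

end

subsection \<open>Strong limit cardinals\<close>

lemma Pow_Field_ordIso: "|Pow (Field k)| =o ctwo ^c k"
  using card_of_Pow_Func[of "Field k"] by (simp add: cexp_def ctwo_def Field_card_of)

context singular
begin

text \<open>These are the codes. For a strong limit \<open>l\<close> there are only
  \<open>|l|\<close> of them, few enough for \<open>small_values\<close>, whereas the subsets of
  size below \<open>|l|\<close> number at least \<open>2^l\<close>.\<close>

definition bounded_subsets :: "'a set set" where
  "bounded_subsets = (\<Union>w\<in>Field l. Pow (underS l w))"

lemma small_Pow:
  assumes "strong_limit l" "|A| <o l"
  shows "|Pow A| <o l"
proof -
  \<comment> \<open>\<open>strong_limit\<close> speaks only of cardinals on the type of
    \<open>l\<close>, so \<open>A\<close> is replaced by an initial segment.\<close>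
  obtain w where w: "w \<in> Field l" "|A| =o |underS l w|"
    using card_less_underS[OF card_l assms(2)] by blast
  have "ctwo ^c |underS l w| <o l"
    using assms(1) small_underS[OF w(1)] card_of_Card_order unfolding strong_limit_def by blast
  then have "|Pow (underS l w)| <o l"
    using ordIso_ordLess_trans[OF Pow_Field_ordIso[of "|underS l w|"]] by (simp add: Field_card_of)
  then show ?thesis
    using card_Pow_mono[OF ordIso_imp_ordLeq[OF w(2)]] by (rule small_le[rotated])
qed

lemma card_bounded_subsets:
  assumes "strong_limit l"
  shows "|bounded_subsets| \<le>o |Field l|"
  unfolding bounded_subsets_def
proof (rule card_of_UNION_ordLeq_infinite[OF infinite_l])
  show "|Field l| \<le>o |Field l|" by (rule card_of_mono1) simp
  show "\<forall>w\<in>Field l. |Pow (underS l w)| \<le>o |Field l|"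
    using small_Pow[OF assms small_underS] card_less_order[OF card_l] ordLess_imp_ordLeq by blast
qed

end

text \<open>If all small subsets of \<open>r\<close> have at most \<open>|M|\<close> subsets, the classes \<open>cl V\<close> are too few to
  exhaust the power set of \<open>r\<close>.  Otherwise pick a small \<open>N\<^sub>0\<close> with more than \<open>|M|\<close> subsets, view
  subsets of \<open>r\<close> as sequences of subsets of \<open>N\<^sub>0\<close>, and diagonalise: the initial segment of length
  \<open>x V\<close> of a member of \<open>cl V\<close> determines its next entry.\<close>

lemma small_determination_contradiction:
  fixes r :: "'b rel" and M :: "'m set" and VV :: "'v set" and N :: "'v \<Rightarrow> 'b set"
  assumes reg: "regular_cardinal r" and M: "infinite M" "|M| <o |Pow (Field r)|"
    and VV: "|VV| \<le>o |M|"
    and N: "\<And>V. V \<in> VV \<Longrightarrow> |N V| <o r"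
    and cl: "\<And>V A B. V \<in> VV \<Longrightarrow> A \<in> cl V \<Longrightarrow> B \<in> cl V \<Longrightarrow> A \<inter> N V = B \<inter> N V \<Longrightarrow> A = B"
    and exhaust: "\<And>A. A \<subseteq> Field r \<Longrightarrow> \<exists>V\<in>VV. A \<in> cl V"
  shows False
proof (cases "\<forall>V\<in>VV. |Pow (N V)| \<le>o |M|")
  case True
  have "|cl V| \<le>o |M|" if V: "V \<in> VV" for V
  proof -
    have "|cl V| \<le>o |Pow (N V)|"
    proof (rule card_inj_image_le)
      show "inj_on (\<lambda>A. A \<inter> N V) (cl V)" using cl[OF V] by (rule inj_onI)
    qed blast
    then show ?thesis using True V ordLeq_transitive by blast
  qed
  then have "|\<Union>V\<in>VV. cl V| \<le>o |M|"
    using card_of_UNION_ordLeq_infinite[OF M(1) VV] by blast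
  moreover have "Pow (Field r) \<subseteq> (\<Union>V\<in>VV. cl V)" using exhaust by blast
  ultimately have "|Pow (Field r)| \<le>o |M|" using card_of_mono1 ordLeq_transitive by blast
  then show False using M(2) not_ordLess_ordLeq by blast
next
  case False
  note r = regular_stable[OF reg]
  obtain V0 where V0: "V0 \<in> VV" "\<not> |Pow (N V0)| \<le>o |M|" using False by blast
  define N0 where "N0 = N V0"
  have big: "|M| <o |Pow N0|" using V0(2) card_not_le_iff unfolding N0_def by blast
  have "|N0| \<le>o |Field r|"
    using N[OF V0(1)] card_less_order[OF r(1)] ordLess_imp_ordLeq unfolding N0_def by blast
  then have "|Field r \<times> N0| \<le>o |Field r|"
    by (intro card_Times_le r(3)) (simp_all add: card_of_mono1)
  then obtain pi where pi: "inj_on pi (Field r \<times> N0)" "\<And>y. y \<in> Field r \<times> N0 \<Longrightarrow> pi y \<in> Field r"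
    by (rule card_leE) blast
  have pi_eq: "pi (a, n) = pi (c, m) \<longleftrightarrow> a = c \<and> n = m"
    if "a \<in> Field r" "c \<in> Field r" "n \<in> N0" "m \<in> N0" for a c n m
    using inj_on_eq_iff[OF pi(1), of "(a, n)" "(c, m)"] that by simp
  \<comment> \<open>\<open>N V\<close> has fewer than \<open>r\<close> points, so it sees only
    entries at positions below some \<open>x V\<close>.\<close>
  have "\<exists>x. x \<in> Field r \<and> (\<forall>a\<in>Field r. \<forall>n\<in>N0. pi (a, n) \<in> N V \<longrightarrow> a \<in> underS r x)"
    if V: "V \<in> VV" for V
  proof -
    let ?B = "{a \<in> Field r. \<exists>n\<in>N0. pi (a, n) \<in> N V}"
    have "?B \<subseteq> (\<lambda>z. fst (inv_into (Field r \<times> N0) pi z)) ` N V"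
    proof
      fix a assume "a \<in> ?B"
      then obtain n where n: "a \<in> Field r" "n \<in> N0" "pi (a, n) \<in> N V" by blast
      then have "a = fst (inv_into (Field r \<times> N0) pi (pi (a, n)))"
        using inv_into_f_f[OF pi(1), of "(a, n)"] by simp
      with n(3) show "a \<in> (\<lambda>z. fst (inv_into (Field r \<times> N0) pi z)) ` N V" by (rule rev_image_eqI)
    qed
    then have "|?B| \<le>o |N V|" by (rule surj_imp_ordLeq)
    then have "|?B| <o r" using N[OF V] by (rule ordLeq_ordLess_trans)
    then obtain x where "x \<in> Field r" "\<And>a. a \<in> ?B \<Longrightarrow> a \<in> underS r x"
      using stable_small_bounded[OF reg, of ?B] by blast
    then show ?thesis by blast
  qed
  then obtain x where x: "\<And>V. V \<in> VV \<Longrightarrow> x V \<in> Field r"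
    "\<And>V a n. V \<in> VV \<Longrightarrow> a \<in> Field r \<Longrightarrow> n \<in> N0 \<Longrightarrow> pi (a, n) \<in> N V \<Longrightarrow> a \<in> underS r (x V)"
    by metis
  \<comment> \<open>\<open>part A e\<close> encodes the entries before position \<open>e\<close>.
    The entry at \<open>e\<close> must differ from the corresponding entry of each member of a class
    with \<open>x V = e\<close> whose trace agrees so far.\<close>
  define part where "part = (\<lambda>A e. {pi (d, n) | d n. d \<in> underS r e \<and> n \<in> A d})"
  define S where "S = (\<lambda>e A a. a \<subseteq> N0 \<and> (\<forall>V\<in>VV. x V = e \<longrightarrow>
      (\<forall>B\<in>cl V. B \<inter> N V = part A e \<inter> N V \<longrightarrow> a \<noteq> {n \<in> N0. pi (e, n) \<in> B})))"
  obtain A where A: "\<And>e. e \<in> Field r \<Longrightarrow> S e A (A e)"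
  proof (rule wo_choice[OF r(2), where S = S])
    show "S e A a \<longleftrightarrow> S e A' a" if "\<And>d. d \<in> underS r e \<Longrightarrow> A d = A' d" for e A A' a
    proof -
      have "part A e = part A' e" using that unfolding part_def by blast
      then show ?thesis by (simp add: S_def)
    qed
    fix e A
    \<comment> \<open>At most one member of \<open>cl V\<close> has the given trace, so each
      \<open>V\<close> forbids at most one entry: at most \<open>|M|\<close> entries in all, fewer
      than the subsets of \<open>N0\<close>.\<close>
    define sel where "sel = (\<lambda>V. SOME B. B \<in> cl V \<and> B \<inter> N V = part A e \<inter> N V)"
    have sel: "sel V = B" if "V \<in> VV" "B \<in> cl V" "B \<inter> N V = part A e \<inter> N V" for V B
    proof -
      have "sel V \<in> cl V \<and> sel V \<inter> N V = part A e \<inter> N V"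
        unfolding sel_def by (rule someI[of _ B]) (use that in simp)
      then show ?thesis using cl[OF that(1), of "sel V" B] that by simp
    qed
    define Fb where "Fb = (\<lambda>V. {n \<in> N0. pi (e, n) \<in> sel V}) ` VV"
    have "|Fb| \<le>o |M|" unfolding Fb_def by (rule ordLeq_transitive[OF card_of_image VV])
    then have "|Fb| <o |Pow N0|" using big by (rule ordLeq_ordLess_trans)
    then have "\<not> Pow N0 \<subseteq> Fb" using card_of_mono1[of "Pow N0" Fb] not_ordLess_ordLeq by blast
    then obtain a where a: "a \<subseteq> N0" "a \<notin> Fb" by blast
    then have "S e A a" unfolding S_def
    proof (intro conjI ballI impI)
      fix V B assume "V \<in> VV" "B \<in> cl V" "B \<inter> N V = part A e \<inter> N V"
      then show "a \<noteq> {n \<in> N0. pi (e, n) \<in> B}" using sel[of V B] a(2) unfolding Fb_def by blast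
    qed
    then show "\<exists>a. S e A a" by blast
  qed blast
  have AN: "A e \<subseteq> N0" if "e \<in> Field r" for e using A[OF that] by (simp add: S_def)
  define B where "B = {pi (d, n) | d n. d \<in> Field r \<and> n \<in> A d}"
  have "B \<subseteq> Field r" unfolding B_def using pi(2) AN by blast
  then obtain V where V: "V \<in> VV" "B \<in> cl V" using exhaust by blast
  \<comment> \<open>Entries from position \<open>x V\<close> on are invisible to \<open>N V\<close>,
    so the earlier ones already give the whole trace.\<close>
  have "B \<inter> N V = part A (x V) \<inter> N V"
  proof (intro equalityI subsetI)
    fix z assume z: "z \<in> B \<inter> N V"
    then obtain d n where dn: "z = pi (d, n)" "d \<in> Field r" "n \<in> A d" unfolding B_def by blast
    then have "d \<in> underS r (x V)" using x(2)[OF V(1) dn(2)] AN[OF dn(2)] z by blast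
    then show "z \<in> part A (x V) \<inter> N V" using dn z unfolding part_def by blast
  next
    fix z assume "z \<in> part A (x V) \<inter> N V"
    then show "z \<in> B \<inter> N V" using underS_in_Field(1)[of _ r "x V"] unfolding part_def B_def by blast
  qed
  then have "A (x V) \<noteq> {n \<in> N0. pi (x V, n) \<in> B}"
    using A[OF x(1)[OF V(1)]] V by (simp add: S_def)
  moreover have "n \<in> A (x V) \<longleftrightarrow> pi (x V, n) \<in> B" if "n \<in> N0" for n
  proof
    show "pi (x V, n) \<in> B" if "n \<in> A (x V)" using that x(1)[OF V(1)] unfolding B_def by blast
    assume "pi (x V, n) \<in> B"
    then obtain d m where "pi (x V, n) = pi (d, m)" "d \<in> Field r" "m \<in> A d" unfolding B_def by blast
    then show "n \<in> A (x V)" using pi_eq[OF x(1)[OF V(1)], of d n m] AN[of d] \<open>n \<in> N0\<close> by blast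
  qed
  ultimately show False using AN[OF x(1)[OF V(1)]] by blast
qed

context uncovered
begin

text \<open>A subset \<open>A\<close> of \<open>r\<close> is traced on the ladder, and the trace is coded by a bounded subset of \<open>l\<close>.
  If two traces take values in one small set \<open>V\<close> of codes, points where members of \<open>V\<close> differ are
  fewer than the ladder is long, so traces that agree on a fixed initial segment are equal.\<close>

lemma traces:
  assumes T: "|bounded_subsets| \<le>o |Field l|"
  obtains cl :: "'a set set \<Rightarrow> 'b set set" and N where
    "\<And>V. V \<in> Pow bounded_subsets \<Longrightarrow> |N V| <o r"
    "\<And>V A B. V \<in> Pow bounded_subsets \<Longrightarrow> A \<in> cl V \<Longrightarrow> B \<in> cl V \<Longrightarrow> A \<inter> N V = B \<inter> N V \<Longrightarrow> A = B"
    "\<And>A. A \<subseteq> Field r \<Longrightarrow> \<exists>V\<in>Pow bounded_subsets. A \<in> cl V"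
proof -
  obtain b where b: "\<forall>e\<in>Field r. \<forall>\<^sub>F i in F. \<exists>z\<in>ladder i. b z = e"
    using ladder_map by (elim exE) (rule that)
  \<comment> \<open>The ladder is injected onto a bounded subset of \<open>l\<close>; the code of
    every trace is then bounded as well.\<close>
  define u where "u = (\<lambda>i. SOME u. inj_on u (ladder i) \<and> u ` ladder i \<in> bounded_subsets)"
  have u: "\<forall>\<^sub>F i in F. inj_on (u i) (ladder i) \<and> u i ` ladder i \<in> bounded_subsets"
    using ladder_small
  proof eventually_elim
    case (elim i)
    obtain w where w: "w \<in> Field l" "|ladder i| =o |underS l w|"
      using card_less_underS[OF card_l elim] by blast
    then obtain f where "inj_on f (ladder i)" "f ` ladder i \<subseteq> underS l w"
      using card_of_ordLeq[of "ladder i" "underS l w"] ordIso_imp_ordLeq by blast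
    then have "\<exists>f. inj_on f (ladder i) \<and> f ` ladder i \<in> bounded_subsets"
      using w(1) unfolding bounded_subsets_def by blast
    then show ?case unfolding u_def by (rule someI_ex)
  qed
  define code where "code = (\<lambda>A i. u i ` {z \<in> ladder i. b z \<in> A})"
  define cl where "cl = (\<lambda>V. {A. A \<subseteq> Field r \<and> |V| <o l \<and> (\<forall>\<^sub>F i in F. code A i \<in> V)})"
  define good where "good = (\<lambda>V x. x \<in> Field r \<and> (\<forall>A B. A \<in> cl V \<longrightarrow> B \<in> cl V \<longrightarrow>
      A \<inter> b ` underS r x = B \<inter> b ` underS r x \<longrightarrow> A = B))"
  have good: "\<exists>x. good V x" for V
  proof (cases "|V| <o l")
    case False
    obtain x where "x \<in> Field r" using infinite_r by fastforce
    then show ?thesis using False by (auto simp: good_def cl_def)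
  next
    case True
    \<comment> \<open>\<open>D i\<close> keeps only one point of disagreement for each pair from
      \<open>V\<close>, so it has at most \<open>|V \<times> V|\<close> points.\<close>
    define df where "df = (\<lambda>i (P, Q). {z \<in> ladder i. u i z \<in> P \<longleftrightarrow> u i z \<notin> Q})"
    define D where "D = (\<lambda>i. (\<lambda>PQ. SOME z. z \<in> df i PQ) ` {PQ \<in> V \<times> V. df i PQ \<noteq> {}})"
    have some_df: "(SOME z. z \<in> df i PQ) \<in> df i PQ" if "df i PQ \<noteq> {}" for i PQ
      using that by (simp add: some_in_eq)
    have D_ladder: "D i \<subseteq> ladder i" for i
      using some_df[of i] unfolding D_def df_def by blast
    have "\<forall>\<^sub>F i in F. D i \<subseteq> underS r (lub i) \<and> |D i| <o |ladder i|"
      using ladder_large[OF small_Times[OF True True]]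
    proof eventually_elim
      case (elim i)
      have "|D i| \<le>o |{PQ \<in> V \<times> V. df i PQ \<noteq> {}}|" unfolding D_def by (rule card_of_image)
      also have "|{PQ \<in> V \<times> V. df i PQ \<noteq> {}}| \<le>o |V \<times> V|" by (rule card_of_mono1) blast
      also note elim
      finally show ?case using D_ladder[of i] ladder_below[of i] by blast
    qed
    then obtain x where x: "x \<in> Field r" "\<forall>\<^sub>F i in F. \<forall>z\<in>D i. z \<in> underS r x"
      by (rule ladder_bounded)
    have "A = B" if AB: "A \<in> cl V" "B \<in> cl V" "A \<inter> b ` underS r x = B \<inter> b ` underS r x" for A B
    proof -
      have agree: "b z \<in> A \<longleftrightarrow> b z \<in> B" if "z \<in> underS r x" for z using AB(3) that by blast
      have AV: "\<forall>\<^sub>F i in F. code A i \<in> V" "\<forall>\<^sub>F i in F. code B i \<in> V"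
        using AB(1,2) by (auto simp: cl_def)
      have eq: "\<forall>\<^sub>F i in F. \<forall>z\<in>ladder i. b z \<in> A \<longleftrightarrow> b z \<in> B"
        using AV x(2) u
      proof eventually_elim
        case (elim i)
        have code: "u i z \<in> code C i \<longleftrightarrow> b z \<in> C" if "z \<in> ladder i" for C z
          using inj_on_image_mem_iff[of "u i" "ladder i" z "{z \<in> ladder i. b z \<in> C}"] elim(4) that
          by (auto simp: code_def)
        have "df i (code A i, code B i) = {}"
        proof (rule ccontr)
          assume ne: "df i (code A i, code B i) \<noteq> {}"
          define d where "d = (SOME z. z \<in> df i (code A i, code B i))"
          have "d \<in> D i" using elim(1,2) ne unfolding D_def d_def by blast
          then have "d \<in> ladder i" "d \<in> underS r x" using elim(3) D_ladder by blast+
          moreover have "d \<in> df i (code A i, code B i)" unfolding d_def by (rule some_df[OF ne])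
          ultimately show False using code agree by (simp add: df_def)
        qed
        then show ?case using code unfolding df_def by blast
      qed
      have "e \<in> A \<longleftrightarrow> e \<in> B" if e: "e \<in> Field r" for e
      proof -
        have "\<forall>\<^sub>F i in F. \<exists>z\<in>ladder i. b z = e" using b e by blast
        with eq have "\<forall>\<^sub>F i in F. e \<in> A \<longleftrightarrow> e \<in> B" by eventually_elim blast
        then show ?thesis using eventually_witness by blast
      qed
      moreover have "A \<subseteq> Field r" "B \<subseteq> Field r" using AB by (auto simp: cl_def)
      ultimately show "A = B" by blast
    qed
    then show ?thesis using x(1) unfolding good_def by blast
  qed
  define x where "x = (\<lambda>V. SOME x. good V x)"
  have x: "good V (x V)" for V unfolding x_def by (rule someI_ex[OF good])
  show thesis
  proof (rule that[of "\<lambda>V. b ` underS r (x V)" cl])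
    show "|b ` underS r (x V)| <o r" for V
    proof (rule ordLeq_ordLess_trans[OF card_of_image card_of_underS[OF card_r]])
      show "x V \<in> Field r" using x[of V] by (simp add: good_def)
    qed
    show "A = B" if "A \<in> cl V" "B \<in> cl V" "A \<inter> b ` underS r (x V) = B \<inter> b ` underS r (x V)" for V A B
      using x[of V] that unfolding good_def by blast
    show "\<exists>V\<in>Pow bounded_subsets. A \<in> cl V" if A: "A \<subseteq> Field r" for A
    proof -
      have "|bounded_subsets| \<le>o l" using T card_le_order[OF card_l] by blast
      moreover have "\<forall>\<^sub>F i in F. code A i \<in> bounded_subsets"
        using u
      proof eventually_elim
        case (elim i)
        then show ?case unfolding bounded_subsets_def code_def by blast
      qed
      ultimately obtain V where "V \<subseteq> bounded_subsets" "|V| <o l" "\<forall>\<^sub>F i in F. code A i \<in> V"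
        by (rule small_values)
      then show ?thesis using A by (auto simp: cl_def)
    qed
  qed
qed

end

lemma (in indecomposable) strong_limit_few_covers:
  assumes "strong_limit l" "regular_cardinal r" "l <o r" "covers F l (Field r)"
    and Pow_less: "|Pow (Field l)| <o |Pow (Field r)|"
  shows "few_covers F l (Field r)"
proof (rule ccontr)
  assume "\<not> few_covers F l (Field r)"
  then interpret uncovered l F r using assms by unfold_locales
  note T = card_bounded_subsets[OF assms(1)]
  show False
  proof (rule traces[OF T])
    fix cl :: "'a set set \<Rightarrow> 'b set set" and N
    assume "\<And>V. V \<in> Pow bounded_subsets \<Longrightarrow> |N V| <o r"
      "\<And>V A B. V \<in> Pow bounded_subsets \<Longrightarrow> A \<in> cl V \<Longrightarrow> B \<in> cl V \<Longrightarrow> A \<inter> N V = B \<inter> N V \<Longrightarrow> A = B"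
      "\<And>A. A \<subseteq> Field r \<Longrightarrow> \<exists>V\<in>Pow bounded_subsets. A \<in> cl V"
    \<comment> \<open>\<open>M\<close> is the power set of \<open>l\<close>, since the classes are
      indexed by sets of bounded subsets.\<close>
    moreover have "infinite (Pow (Field l))" using infinite_l by (simp add: finite_Pow_iff)
    ultimately show False
      using small_determination_contradiction[OF reg _ Pow_less card_Pow_mono[OF T], of N cl] by blast
  qed
qed

subsection \<open>Possible cofinalities\<close>

context
  fixes l :: "'a rel"
  assumes wo_l: "Well_order l"
begin

lemma Field_below: "Field (below l w) = underS l w"
  unfolding below_def
  by (rule Refl_Field_Restr2) (use wo_l in \<open>auto simp: underS_Field wo_rel.REFL wo_rel_def\<close>)

lemma below_iff: "(x, y) \<in> below l w \<longleftrightarrow> (x, y) \<in> l \<and> x \<in> underS l w \<and> y \<in> underS l w"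
  by (auto simp: below_def)

lemma underS_below: "x \<in> underS l w \<Longrightarrow> underS (below l w) x = underS l x"
  using wo_le_less_trans[OF wo_l] by (auto simp: underS_def below_iff)

lemma card_underS_below:
  assumes "Card_order (below l w)" "x \<in> underS l w"
  shows "|underS l x| <o below l w"
  using card_of_underS[OF assms(1), of x] assms(2) by (simp add: Field_below underS_below)

text \<open>A proper initial segment of a cardinal is smaller than it. This provides the
  distinctness demanded by \<open>in_pcf\<close>.\<close>

lemma below_inj_ordIso:
  assumes xy: "x \<in> Field l" "y \<in> Field l" and iso: "below l x =o below l y"
    and card: "Card_order (below l x)" "Card_order (below l y)"
  shows "x = y"
proof -
  have no: False if "a \<in> underS l c" "below l a =o below l c" "Card_order (below l a)" "Card_order (below l c)" for a c
  proof -
    have "below l a <o below l c"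
      by (rule iffD2[OF order_less_card[OF that(3)]]) (simp add: Field_below card_underS_below[OF that(4,1)])
    then show False using that(2) not_ordLess_ordIso by blast
  qed
  show ?thesis
    using no[of x y] no[of y x] iso ordIso_symmetric[OF iso] card
    by (cases rule: wo_cases[OF wo_l xy]) (auto simp: underS_def)
qed

text \<open>The cofinality of a cofinality is itself. \<open>C\<close> is enumerated along
  \<open>below l w\<close> in no particular order: the piece before each \<open>k\<close> in
  \<open>K\<close> is bounded merely because it has fewer than \<open>|C|\<close> elements, and the
  bounds for a cofinal \<open>K\<close> form a cofinal set.\<close>

lemma shortest_cofinal_regular:
  assumes r: "Well_order r" and C: "shortest_cofinal r p C" "infinite C" and iso: "|C| =o below l w"
  shows "regular_cardinal (below l w)"
proof -
  have card: "Card_order (below l w)" using iso card_of_Card_order Card_order_ordIso2 by blast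
  have isoU: "|C| =o |underS l w|"
    using card_of_cong[OF iso] by (simp add: Field_card_of Field_below)
  then have inf: "infinite (underS l w)" using C(2) card_of_ordIso_finite by blast
  obtain c where c: "bij_betw c (underS l w) C"
    using card_of_ordIso[of "underS l w" C] ordIso_symmetric[OF isoU] by blast
  have "|K| =o below l w" if K: "K \<subseteq> underS l w" "cofinal K (below l w)" for K
  proof (rule ccontr)
    assume "\<not> |K| =o below l w"
    moreover have "|K| \<le>o below l w"
      by (rule iffD2[OF card_le_order[OF card]]) (simp add: Field_below card_of_mono1[OF K(1)])
    ultimately have "|K| <o below l w" using ordLeq_iff_ordLess_or_ordIso by blast
    then have KC: "|K| <o |C|" using ordIso_symmetric[OF iso] by (rule ordLess_ordIso_trans)
    have "\<exists>q. q \<in> underS r p \<and> (\<forall>z\<in>c ` underS l k. (z, q) \<in> r)" if k: "k \<in> K" for k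
    proof -
      have kw: "k \<in> underS l w" using k K(1) by blast
      have "|c ` underS l k| <o below l w"
        by (rule ordLeq_ordLess_trans[OF card_of_image card_underS_below[OF card kw]])
      then have 1: "|c ` underS l k| <o |C|" using ordIso_symmetric[OF iso] by (rule ordLess_ordIso_trans)
      have "underS l k \<subseteq> underS l w" by (rule underS_mono[OF wo_l underS_le[OF kw]])
      then have "c ` underS l k \<subseteq> underS r p"
        using c shortest_cofinalD(1)[OF C(1)] by (auto simp: bij_betw_def)
      then obtain q where "q \<in> underS r p" "\<And>z. z \<in> c ` underS l k \<Longrightarrow> (z, q) \<in> r"
        using shortest_cofinal_bounded[OF r C(1) _ 1] by blast
      then show ?thesis by blast
    qed
    then obtain q where q: "\<And>k. k \<in> K \<Longrightarrow> q k \<in> underS r p"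
      "\<And>k z. k \<in> K \<Longrightarrow> z \<in> c ` underS l k \<Longrightarrow> (z, q k) \<in> r"
      by metis
    have "cofinal_below r p (q ` K)"
      unfolding cofinal_below_def
    proof (intro conjI ballI)
      show "q ` K \<subseteq> underS r p" using q(1) by blast
      fix y assume "y \<in> underS r p"
      then obtain z where z: "z \<in> C" "(y, z) \<in> r" using shortest_cofinalD(2)[OF C(1)] by blast
      then obtain m where m: "m \<in> underS l w" "z = c m" using c by (auto simp: bij_betw_def)
      obtain k where k: "k \<in> K" "m \<noteq> k" "(m, k) \<in> below l w"
        using K(2) m(1) unfolding cofinal_def Field_below by blast
      then have "(z, q k) \<in> r" using q(2)[OF k(1)] m(2) by (simp add: below_iff underS_def)
      then show "\<exists>z\<in>q ` K. (y, z) \<in> r" using wo_trans[OF r z(2)] k(1) by blast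
    qed
    then have "|C| \<le>o |q ` K|" by (rule shortest_cofinalD(3)[OF C(1)])
    then have "|C| \<le>o |K|" using card_of_image ordLeq_transitive by blast
    then show False using KC not_ordLess_ordLeq by blast
  qed
  then show ?thesis
    using card inf by (simp add: regular_cardinal_def cinfinite_def regularCard_def Field_below)
qed

end

lemma (in indecomposable) ultrafilter_image:
  assumes "\<forall>\<^sub>F i in F. f i \<in> R"
  shows "ultrafilter_on R {Q. Q \<subseteq> R \<and> (\<forall>\<^sub>F i in F. f i \<in> Q)}"
  unfolding ultrafilter_on_def
proof (intro conjI ballI allI impI)
  show "{} \<notin> {Q. Q \<subseteq> R \<and> (\<forall>\<^sub>F i in F. f i \<in> Q)}"
    using not_bot by (simp add: eventually_False)
  show "X \<inter> Y \<in> {Q. Q \<subseteq> R \<and> (\<forall>\<^sub>F i in F. f i \<in> Q)}"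
    if "X \<in> {Q. Q \<subseteq> R \<and> (\<forall>\<^sub>F i in F. f i \<in> Q)}" "Y \<in> {Q. Q \<subseteq> R \<and> (\<forall>\<^sub>F i in F. f i \<in> Q)}" for X Y
    using that by (auto simp: eventually_conj_iff)
  show "Y \<in> {Q. Q \<subseteq> R \<and> (\<forall>\<^sub>F i in F. f i \<in> Q)}"
    if "X \<in> {Q. Q \<subseteq> R \<and> (\<forall>\<^sub>F i in F. f i \<in> Q)}" "X \<subseteq> Y \<and> Y \<subseteq> R" for X Y
  proof -
    have "\<forall>\<^sub>F i in F. f i \<in> X" using that(1) by simp
    then have "\<forall>\<^sub>F i in F. f i \<in> Y" by eventually_elim (use that(2) in blast)
    then show ?thesis using that(2) by simp
  qed
  show "X \<in> {Q. Q \<subseteq> R \<and> (\<forall>\<^sub>F i in F. f i \<in> Q)} \<or> R - X \<in> {Q. Q \<subseteq> R \<and> (\<forall>\<^sub>F i in F. f i \<in> Q)}"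
    if "X \<subseteq> R" for X
  proof (cases "\<forall>\<^sub>F i in F. f i \<in> X")
    case True
    then show ?thesis using that by simp
  next
    case False
    then have "\<forall>\<^sub>F i in F. f i \<notin> X" using not_eventually_iff[of "\<lambda>i. f i \<in> X"] by blast
    then have "\<forall>\<^sub>F i in F. f i \<in> R - X" using assms by eventually_elim simp
    then show ?thesis by simp
  qed
qed (use assms in auto)

text \<open>A criterion free of quotients, with \<open>U\<close> the image of \<open>F\<close> under
  \<open>rho\<close>. By \<open>dom\<close> the classes of the \<open>G x\<close> dominate, so the
  cofinality is at most \<open>r\<close>; by \<open>unb\<close> no family of fewer than
  \<open>r\<close> functions dominates them, so it is at least \<open>r\<close>.\<close>

lemma (in indecomposable) ultraproduct_cofinality:
  fixes R :: "'c rel set" and rho :: "'i \<Rightarrow> 'c rel" and r :: "'b rel" and G :: "'b \<Rightarrow> 'c rel \<Rightarrow> 'c"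
  defines "U \<equiv> {Q. Q \<subseteq> R \<and> (\<forall>\<^sub>F i in F. rho i \<in> Q)}"
  assumes r: "Card_order r"
    and R: "\<And>s. s \<in> R \<Longrightarrow> Well_order s" and rho: "\<forall>\<^sub>F i in F. rho i \<in> R"
    and G: "\<And>x. x \<in> Field r \<Longrightarrow> G x \<in> Pi\<^sub>E R Field"
    and dom: "\<And>h. h \<in> Pi\<^sub>E R Field \<Longrightarrow> \<exists>x\<in>Field r. \<forall>\<^sub>F i in F. (h (rho i), G x (rho i)) \<in> rho i"
    and unb: "\<And>H. H \<subseteq> Pi\<^sub>E R Field \<Longrightarrow> |H| <o r \<Longrightarrow>
        \<exists>x\<in>Field r. \<forall>h\<in>H. \<not> (\<forall>\<^sub>F i in F. (G x (rho i), h (rho i)) \<in> rho i)"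
  shows "r =o cofinality (ultraproduct_order R U)"
proof -
  let ?P = "Pi\<^sub>E R Field"
  let ?E = "ultraproduct_rel R U"
  let ?O = "ultraproduct_order R U"
  define le where "le = (\<lambda>f g. \<forall>\<^sub>F i in F. (f (rho i), g (rho i)) \<in> rho i)"
  have U: "{s \<in> R. Q s} \<in> U \<longleftrightarrow> (\<forall>\<^sub>F i in F. Q (rho i))" for Q
    using rho by (auto simp: U_def eventually_conj_iff)
  have E: "(f, g) \<in> ?E \<longleftrightarrow> f \<in> ?P \<and> g \<in> ?P \<and> (\<forall>\<^sub>F i in F. f (rho i) = g (rho i))" for f g
    by (simp add: ultraproduct_rel_def U)
  have equiv: "equiv ?P ?E"
  proof (rule equivI)
    show "?E \<subseteq> ?P \<times> ?P" by (auto simp: E)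
    show "refl_on ?P ?E" by (rule refl_onI) (simp add: E)
    show "sym ?E" by (rule symI) (simp add: E eq_commute)
    show "trans ?E"
    proof (rule transI)
      fix f g h assume fg: "(f, g) \<in> ?E" and gh: "(g, h) \<in> ?E"
      have "\<forall>\<^sub>F i in F. f (rho i) = g (rho i)" "\<forall>\<^sub>F i in F. g (rho i) = h (rho i)"
        using fg gh by (simp_all add: E)
      then have "\<forall>\<^sub>F i in F. f (rho i) = h (rho i)" by eventually_elim simp
      then show "(f, h) \<in> ?E" using fg gh by (simp add: E)
    qed
  qed
  have cls: "?E `` {f} \<in> ultraproduct R U" if "f \<in> ?P" for f
    unfolding ultraproduct_def by (rule quotientI[OF that])
  have rep: "\<exists>f\<in>?P. X = ?E `` {f}" if "X \<in> ultraproduct R U" for X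
    using that unfolding ultraproduct_def quotient_def by blast
  have O_iff: "(?E `` {f}, ?E `` {g}) \<in> ?O \<longleftrightarrow> le f g" if fg: "f \<in> ?P" "g \<in> ?P" for f g
  proof
    assume "(?E `` {f}, ?E `` {g}) \<in> ?O"
    then obtain f' g' where *: "(f, f') \<in> ?E" "(g, g') \<in> ?E" "{s \<in> R. (f' s, g' s) \<in> s} \<in> U"
      unfolding ultraproduct_order_def by blast
    then have "\<forall>\<^sub>F i in F. f (rho i) = f' (rho i)" "\<forall>\<^sub>F i in F. g (rho i) = g' (rho i)"
      "\<forall>\<^sub>F i in F. (f' (rho i), g' (rho i)) \<in> rho i"
      by (simp_all add: E U)
    then show "le f g" unfolding le_def by eventually_elim simp
  next
    assume "le f g"
    then have "{s \<in> R. (f s, g s) \<in> s} \<in> U" by (simp add: le_def U)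
    moreover have "f \<in> ?E `` {f}" "g \<in> ?E `` {g}" using fg by (simp_all add: E)
    ultimately show "(?E `` {f}, ?E `` {g}) \<in> ?O"
      unfolding ultraproduct_order_def using cls[OF fg(1)] cls[OF fg(2)] by blast
  qed
  have le_refl: "le f f" if "f \<in> ?P" for f
    unfolding le_def using rho
  proof eventually_elim
    case (elim i)
    then show ?case using wo_refl[OF R[OF elim]] PiE_mem[OF that elim] by blast
  qed
  have Field_O: "Field ?O = ultraproduct R U"
  proof (intro equalityI subsetI)
    fix X assume "X \<in> Field ?O"
    then show "X \<in> ultraproduct R U" by (auto simp: Field_def ultraproduct_order_def)
  next
    fix X assume "X \<in> ultraproduct R U"
    then obtain f where f: "f \<in> ?P" "X = ?E `` {f}" using rep by blast
    then have "(X, X) \<in> ?O" using O_iff le_refl by simp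
    then show "X \<in> Field ?O" by (rule FieldI1)
  qed
  have "Refl ?O"
  proof (rule refl_onI)
    fix X assume "X \<in> Field ?O"
    then obtain f where "f \<in> ?P" "X = ?E `` {f}" using rep Field_O by blast
    then show "(X, X) \<in> ?O" using O_iff le_refl by simp
  qed
  note spec = cofinality_spec[OF this]
  have "dominating ((\<lambda>x. ?E `` {G x}) ` Field r) ?O"
    unfolding dominating_def Field_O
  proof (intro conjI ballI)
    show "(\<lambda>x. ?E `` {G x}) ` Field r \<subseteq> ultraproduct R U" using cls[OF G] by blast
    fix X assume "X \<in> ultraproduct R U"
    then obtain h where h: "h \<in> ?P" "X = ?E `` {h}" using rep by blast
    obtain x where x: "x \<in> Field r" "\<forall>\<^sub>F i in F. (h (rho i), G x (rho i)) \<in> rho i"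
      using dom[OF h(1)] by (elim bexE) (rule that)
    then have "(X, ?E `` {G x}) \<in> ?O" using O_iff[OF h(1) G[OF x(1)]] h(2) by (simp add: le_def)
    then show "\<exists>Y\<in>(\<lambda>x. ?E `` {G x}) ` Field r. (X, Y) \<in> ?O" using x(1) by blast
  qed
  then have "cofinality ?O \<le>o |(\<lambda>x. ?E `` {G x}) ` Field r|" using spec by simp
  also have "|(\<lambda>x. ?E `` {G x}) ` Field r| \<le>o |Field r|" by (rule card_of_image)
  also have "|Field r| =o r" by (rule card_of_Field_ordIso[OF r])
  finally have 1: "cofinality ?O \<le>o r" .
  obtain A where A: "dominating A ?O" "cofinality ?O = |A|" using spec by blast
  have "\<not> |A| <o r"
  proof
    assume small: "|A| <o r"
    define sel where "sel = (\<lambda>X. SOME f. f \<in> ?P \<and> X = ?E `` {f})"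
    have sel: "sel X \<in> ?P \<and> X = ?E `` {sel X}" if "X \<in> A" for X
    proof -
      have "X \<in> ultraproduct R U" using A(1) that unfolding dominating_def Field_O by blast
      then have "\<exists>f. f \<in> ?P \<and> X = ?E `` {f}" using rep by blast
      then show ?thesis unfolding sel_def by (rule someI_ex)
    qed
    have "sel ` A \<subseteq> ?P" using sel by blast
    moreover have "|sel ` A| <o r" using small by (rule ordLeq_ordLess_trans[OF card_of_image])
    ultimately have "\<exists>x\<in>Field r. \<forall>h\<in>sel ` A. \<not> (\<forall>\<^sub>F i in F. (G x (rho i), h (rho i)) \<in> rho i)"
      by (rule unb)
    then have "\<exists>x\<in>Field r. \<forall>h\<in>sel ` A. \<not> le (G x) h" unfolding le_def .
    then obtain x where x: "x \<in> Field r" "\<forall>h\<in>sel ` A. \<not> le (G x) h" by (elim bexE) (rule that)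
    obtain X where X: "X \<in> A" "(?E `` {G x}, X) \<in> ?O"
      using A(1) cls[OF G[OF x(1)]] unfolding dominating_def Field_O by blast
    then have "(?E `` {G x}, ?E `` {sel X}) \<in> ?O" using sel by simp
    then have "le (G x) (sel X)" using O_iff[OF G[OF x(1)], of "sel X"] sel X(1) by simp
    then show False using x(2) X(1) by simp
  qed
  then have "r \<le>o |A|" by (rule iffD1[OF not_card_less_order[OF r]])
  then have "r \<le>o cofinality ?O" by (simp add: A(2))
  with 1 show ?thesis by (simp add: ordIso_iff_ordLeq)
qed


context uncovered
begin

text \<open>Each constant \<open>x\<close> yields a function \<open>G x\<close> on the lengths of
  the ladders, and each function on the lengths yields a constant bounding the ladder points it cuts
  off. The two translations transfer the cofinality of \<open>r\<close> to the ultraproduct.\<close>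

lemma in_pcf_ladder:
  "\<exists>A. A \<subseteq> Field l \<and> (\<forall>x\<in>A. regular_cardinal (below l x)) \<and> |A| <o l \<and> cofinal A l \<and>
    in_pcf r (below l ` A)"
proof -
  define w where "w = (\<lambda>i. SOME w. w \<in> Field l \<and> |ladder i| =o below l w)"
  have w: "\<forall>\<^sub>F i in F. w i \<in> Field l \<and> |ladder i| =o below l (w i)"
    using ladder_small
  proof eventually_elim
    case (elim i)
    have "\<exists>w. w \<in> Field l \<and> |ladder i| =o below l w"
      using card_less_underS[OF card_l elim] by blast
    then show ?case unfolding w_def by (rule someI_ex)
  qed
  have nat_small: "|UNIV :: nat set| <o l"
  proof -
    obtain v where v: "v \<in> Field l" "infinite (underS l v)" by (rule infinite_underS)
    then have "|UNIV :: nat set| \<le>o |underS l v|" using infinite_iff_card_of_nat by blast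
    then show ?thesis using small_underS[OF v(1)] by (rule small_le)
  qed
  have reg_w: "\<forall>\<^sub>F i in F. w i \<in> {w \<in> Field l. regular_cardinal (below l w)}"
    using w ladder_large[OF nat_small]
  proof eventually_elim
    case (elim i)
    have "infinite (ladder i)"
      using ordLess_imp_ordLeq[OF elim(2)] infinite_iff_card_of_nat by blast
    then show ?case using shortest_cofinal_regular[OF wo_l wo_r ladder] elim(1) by blast
  qed
  have "|{w \<in> Field l. regular_cardinal (below l w)}| \<le>o |Field l|" by (rule card_of_mono1) blast
  then have "|{w \<in> Field l. regular_cardinal (below l w)}| \<le>o l" using card_le_order[OF card_l] by blast
  then obtain W where W: "W \<subseteq> {w \<in> Field l. regular_cardinal (below l w)}" "|W| <o l"
    "\<forall>\<^sub>F i in F. w i \<in> W"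
    using reg_w by (rule small_values)
  \<comment> \<open>The ladders outgrow every initial segment of \<open>l\<close>, hence so do the
    elements \<open>w i\<close> that represent their lengths.\<close>
  have cofW: "cofinal W l"
    unfolding cofinal_def
  proof
    fix a assume a: "a \<in> Field l"
    have "\<forall>\<^sub>F i in F. w i \<in> W \<and> a \<in> underS l (w i)"
      using W(3) w ladder_large[OF small_underS[OF a]]
    proof eventually_elim
      case (elim i)
      have "\<not> (w i, a) \<in> l"
      proof
        assume "(w i, a) \<in> l"
        then have "|underS l (w i)| \<le>o |underS l a|" by (rule card_underS_mono[OF wo_l])
        moreover have "|ladder i| =o |underS l (w i)|"
          using card_of_cong[OF conjunct2[OF elim(2)]] by (simp add: Field_card_of Field_below[OF wo_l])
        ultimately have "|ladder i| \<le>o |underS l a|" using ordIso_ordLeq_trans by blast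
        then show False using elim(3) not_ordLess_ordLeq by blast
      qed
      then show ?case using elim a wo_not_le_iff[OF wo_l, of "w i" a] by blast
    qed
    then obtain i where "w i \<in> W" "a \<in> underS l (w i)" using eventually_witness by blast
    then show "\<exists>b\<in>W. a \<noteq> b \<and> (a, b) \<in> l" by (auto simp: underS_def)
  qed
  define R where "R = below l ` W"
  define rho where "rho = (\<lambda>i. below l (w i))"
  have rho: "\<forall>\<^sub>F i in F. rho i \<in> R"
    using W(3) by eventually_elim (simp add: rho_def R_def)
  have iso: "\<forall>\<^sub>F i in F. |ladder i| =o rho i"
    using w by eventually_elim (simp add: rho_def)
  have R_reg: "regular_cardinal s" if "s \<in> R" for s using that W(1) by (auto simp: R_def)
  have R_Field: "Field s \<subseteq> Field l" if "s \<in> R" for s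
    using that underS_in_Field(1) by (auto simp: R_def Field_below[OF wo_l])
  \<comment> \<open>The bijection need not respect the orders; all bounds below come from
    cardinalities.\<close>
  define c where "c = (\<lambda>i. SOME c. bij_betw c (Field (rho i)) (ladder i))"
  have c: "\<forall>\<^sub>F i in F. bij_betw (c i) (Field (rho i)) (ladder i)"
    using iso
  proof eventually_elim
    case (elim i)
    have "|ladder i| =o |Field (rho i)|"
      using card_of_cong[OF elim] by (simp add: Field_card_of)
    then have "\<exists>c. bij_betw c (Field (rho i)) (ladder i)"
      using card_of_ordIso ordIso_symmetric by blast
    then show ?case unfolding c_def by (rule someI_ex)
  qed
  \<comment> \<open>The points at positions before \<open>h (rho i)\<close> are fewer than the
    ladder, so a constant bounds them.\<close>
  have bounded: "\<exists>x. x \<in> Field r \<and> (\<forall>\<^sub>F i in F. \<forall>m\<in>underS (rho i) (h (rho i)). c i m \<in> underS r x)"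
    if h: "h \<in> Pi\<^sub>E R Field" for h
  proof -
    have "\<forall>\<^sub>F i in F. c i ` underS (rho i) (h (rho i)) \<subseteq> underS r (lub i) \<and>
        |c i ` underS (rho i) (h (rho i))| <o |ladder i|"
      using rho iso c
    proof eventually_elim
      case (elim i)
      have "h (rho i) \<in> Field (rho i)" using PiE_mem[OF h elim(1)] .
      then have "|underS (rho i) (h (rho i))| <o rho i"
        by (rule card_of_underS[OF regular_stable(1)[OF R_reg[OF elim(1)]]])
      then have "|c i ` underS (rho i) (h (rho i))| <o |ladder i|"
        using ordLess_ordIso_trans[OF ordLeq_ordLess_trans[OF card_of_image] ordIso_symmetric[OF elim(2)]]
        by blast
      moreover have "c i ` underS (rho i) (h (rho i)) \<subseteq> ladder i"
        using elim(3) underS_in_Field(1)[of _ "rho i" "h (rho i)"] by (auto simp: bij_betw_def)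
      ultimately show ?case using ladder_below[of i] by blast
    qed
    then obtain x where x: "x \<in> Field r"
      "\<forall>\<^sub>F i in F. \<forall>z\<in>c i ` underS (rho i) (h (rho i)). z \<in> underS r x"
      by (rule ladder_bounded)
    from x(2) have "\<forall>\<^sub>F i in F. \<forall>m\<in>underS (rho i) (h (rho i)). c i m \<in> underS r x"
      by eventually_elim blast
    with x(1) show ?thesis by (intro exI conjI)
  qed
  have scale: "\<exists>g m. g \<in> Pi\<^sub>E R Field \<and> (\<forall>\<^sub>F i in F. (x, c i (m i)) \<in> r \<and>
      m i \<in> underS (rho i) (g (rho i)))" if x: "x \<in> Field r" for x
  proof -
    define m where "m = (\<lambda>i. SOME m. m \<in> Field (rho i) \<and> (x, c i m) \<in> r)"
    have m: "\<forall>\<^sub>F i in F. m i \<in> Field (rho i) \<and> (x, c i (m i)) \<in> r"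
      using below_lub[OF x] c
    proof eventually_elim
      case (elim i)
      obtain z where "z \<in> ladder i" "(x, z) \<in> r" using ladder_cofinal[OF elim(1)] by blast
      moreover from this obtain m where "m \<in> Field (rho i)" "z = c i m"
        using elim(2) unfolding bij_betw_def by blast
      ultimately have "\<exists>m. m \<in> Field (rho i) \<and> (x, c i m) \<in> r" by blast
      then show ?case unfolding m_def by (rule someI_ex)
    qed
    \<comment> \<open>The position \<open>m i\<close> depends on the index, but \<open>g\<close> may
      depend only on \<open>rho i\<close>. The positions lie in one small \<open>V\<close>, almost
      always smaller than \<open>rho i\<close>, so a bound of \<open>V\<close> in
      \<open>rho i\<close> also bounds \<open>m i\<close>.\<close>
    have "|Field l| \<le>o l" using card_of_Field_ordIso[OF card_l] by (rule ordIso_imp_ordLeq)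
    moreover have "\<forall>\<^sub>F i in F. m i \<in> Field l"
      using m rho by eventually_elim (use R_Field in blast)
    ultimately obtain V where V: "|V| <o l" "\<forall>\<^sub>F i in F. m i \<in> V" by (rule small_values)
    define Q where "Q = (\<lambda>s y. y \<in> Field s \<and> ( |V| <o s \<longrightarrow> (\<forall>v\<in>V \<inter> Field s. v \<in> underS s y)))"
    define g where "g = restrict (\<lambda>s. SOME y. Q s y) R"
    have g: "Q s (g s)" if s: "s \<in> R" for s
    proof -
      note s' = regular_stable[OF R_reg[OF s]]
      have "\<exists>y. Q s y"
      proof (cases "|V| <o s")
        case True
        have "|V \<inter> Field s| \<le>o |V|" by (rule card_of_mono1) blast
        then have "|V \<inter> Field s| <o s" using True by (rule ordLeq_ordLess_trans)
        with Int_lower2 obtain y where "y \<in> Field s" "\<And>v. v \<in> V \<inter> Field s \<Longrightarrow> v \<in> underS s y"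
          by (rule stable_small_bounded[OF R_reg[OF s]]) blast
        then show ?thesis unfolding Q_def by blast
      next
        case False
        obtain y where "y \<in> Field s" using s'(3) by fastforce
        then show ?thesis using False unfolding Q_def by blast
      qed
      then have "Q s (SOME y. Q s y)" by (rule someI_ex)
      then show ?thesis using s by (simp add: g_def)
    qed
    have "g \<in> Pi\<^sub>E R Field" using g by (auto simp: g_def Q_def)
    moreover have "\<forall>\<^sub>F i in F. (x, c i (m i)) \<in> r \<and> m i \<in> underS (rho i) (g (rho i))"
      using m V(2) rho iso ladder_large[OF V(1)]
    proof eventually_elim
      case (elim i)
      have "|V| <o rho i" using elim(5,4) by (rule ordLess_ordIso_trans)
      then show ?case using g[OF elim(3)] elim(1,2) unfolding Q_def by blast
    qed
    ultimately show ?thesis by blast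
  qed
  define G where "G = (\<lambda>x. SOME g. \<exists>m. g \<in> Pi\<^sub>E R Field \<and> (\<forall>\<^sub>F i in F. (x, c i (m i)) \<in> r \<and>
      m i \<in> underS (rho i) (g (rho i))))"
  have G: "\<exists>m. G x \<in> Pi\<^sub>E R Field \<and> (\<forall>\<^sub>F i in F. (x, c i (m i)) \<in> r \<and>
      m i \<in> underS (rho i) (G x (rho i)))" if "x \<in> Field r" for x
    using someI_ex[OF scale[OF that]] unfolding G_def .
  have cof: "r =o cofinality (ultraproduct_order R {Q. Q \<subseteq> R \<and> (\<forall>\<^sub>F i in F. rho i \<in> Q)})"
  proof (rule ultraproduct_cofinality[OF card_r _ rho, where G = G])
    show "Well_order s" if "s \<in> R" for s using regular_stable(2)[OF R_reg[OF that]] .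
    show "G x \<in> Pi\<^sub>E R Field" if "x \<in> Field r" for x using G[OF that] by blast
    show "\<exists>x\<in>Field r. \<forall>\<^sub>F i in F. (h (rho i), G x (rho i)) \<in> rho i" if h: "h \<in> Pi\<^sub>E R Field" for h
    proof -
      obtain x where x: "x \<in> Field r"
        "\<forall>\<^sub>F i in F. \<forall>m\<in>underS (rho i) (h (rho i)). c i m \<in> underS r x"
        using bounded[OF h] by (elim exE conjE) (rule that)
      obtain m where m: "\<forall>\<^sub>F i in F. (x, c i (m i)) \<in> r \<and> m i \<in> underS (rho i) (G x (rho i))"
        using G[OF x(1)] by (elim exE conjE) (rule that)
      \<comment> \<open>Points before \<open>h (rho i)\<close> are mapped below \<open>x\<close> and
        \<open>c i (m i)\<close> is not, so \<open>m i\<close> is at or beyond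
        \<open>h (rho i)\<close>.\<close>
      have "\<forall>\<^sub>F i in F. (h (rho i), G x (rho i)) \<in> rho i"
        using x(2) m rho
      proof eventually_elim
        case (elim i)
        note s = regular_stable(2)[OF R_reg[OF elim(3)]]
        have mF: "m i \<in> Field (rho i)" by (rule underS_in_Field(1)[OF conjunct2[OF elim(2)]])
        have hF: "h (rho i) \<in> Field (rho i)" using PiE_mem[OF h elim(3)] .
        have "m i \<notin> underS (rho i) (h (rho i))"
          using elim(1,2) wo_not_less[OF wo_r] by blast
        then have "(h (rho i), m i) \<in> rho i" using wo_not_le_iff[OF s hF mF] by blast
        then show ?case by (rule wo_trans[OF s _ underS_le[OF conjunct2[OF elim(2)]]])
      qed
      with x(1) show ?thesis by (rule bexI[rotated])
    qed
    show "\<exists>x\<in>Field r. \<forall>h\<in>H. \<not> (\<forall>\<^sub>F i in F. (G x (rho i), h (rho i)) \<in> rho i)"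
      if H: "H \<subseteq> Pi\<^sub>E R Field" "|H| <o r" for H
    proof -
      define X where "X = (\<lambda>h. SOME x. x \<in> Field r \<and>
        (\<forall>\<^sub>F i in F. \<forall>m\<in>underS (rho i) (h (rho i)). c i m \<in> underS r x))"
      have X: "X h \<in> Field r \<and> (\<forall>\<^sub>F i in F. \<forall>m\<in>underS (rho i) (h (rho i)). c i m \<in> underS r (X h))"
        if "h \<in> H" for h
        using someI_ex[OF bounded[of h]] that H(1) unfolding X_def by blast
      have "X ` H \<subseteq> Field r" using X by blast
      moreover have "|X ` H| <o r" using H(2) by (rule ordLeq_ordLess_trans[OF card_of_image])
      ultimately obtain x where x: "x \<in> Field r" "\<And>y. y \<in> X ` H \<Longrightarrow> y \<in> underS r x"
        by (rule stable_small_bounded[OF reg]) blast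
      \<comment> \<open>Now \<open>x\<close> exceeds the constants belonging to all of
        \<open>H\<close>. If \<open>G x\<close> were below \<open>h\<close>, the position
        \<open>m i\<close> would precede \<open>h (rho i)\<close>, and \<open>c i (m i)\<close>
        would lie below \<open>x\<close>.\<close>
      have "\<not> (\<forall>\<^sub>F i in F. (G x (rho i), h (rho i)) \<in> rho i)" if h: "h \<in> H" for h
      proof
        assume le: "\<forall>\<^sub>F i in F. (G x (rho i), h (rho i)) \<in> rho i"
        obtain m where m: "\<forall>\<^sub>F i in F. (x, c i (m i)) \<in> r \<and> m i \<in> underS (rho i) (G x (rho i))"
          using G[OF x(1)] by (elim exE conjE) (rule that)
        have Xx: "(X h, x) \<in> r" by (rule underS_le, rule x(2), rule imageI, rule h)
        have "\<forall>\<^sub>F i in F. False"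
          using le m conjunct2[OF X[OF h]] rho
        proof eventually_elim
          case (elim i)
          note s = regular_stable(2)[OF R_reg[OF elim(4)]]
          have "m i \<in> underS (rho i) (h (rho i))"
            using elim(1,2) wo_less_le_trans[OF s] by blast
          then have "c i (m i) \<in> underS r (X h)" using elim(3) by blast
          then have "c i (m i) \<in> underS r x" using wo_less_le_trans[OF wo_r _ Xx] by blast
          then show False using elim(2) wo_not_less[OF wo_r] by blast
        qed
        then show False using not_bot by (simp add: eventually_False)
      qed
      with x(1) show ?thesis by blast
    qed
  qed
  have "in_pcf r R"
    unfolding in_pcf_def
  proof (intro conjI ballI impI exI)
    show "regular_cardinal s" if "s \<in> R" for s using R_reg[OF that] .
    show "s = t" if st: "s \<in> R" "t \<in> R" "s =o t" for s t
    proof -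
      obtain x y where xy: "x \<in> W" "y \<in> W" "s = below l x" "t = below l y" using st by (auto simp: R_def)
      then have "x = y"
        using below_inj_ordIso[OF wo_l, of x y] st R_reg regular_stable(1) W(1) by blast
      then show ?thesis using xy by simp
    qed
    show "ultrafilter_on R {Q. Q \<subseteq> R \<and> (\<forall>\<^sub>F i in F. rho i \<in> Q)}" by (rule ultrafilter_image[OF rho])
    show "r =o cofinality (ultraproduct_order R {Q. Q \<subseteq> R \<and> (\<forall>\<^sub>F i in F. rho i \<in> Q)})" by (rule cof)
  qed
  then have "in_pcf r (below l ` W)" by (simp add: R_def)
  moreover have "W \<subseteq> Field l" "\<forall>x\<in>W. regular_cardinal (below l x)" using W(1) by blast+
  ultimately show ?thesis using W(2) cofW by blast
qed

end

subsection \<open>Small subsets and their cofinality\<close>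

context singular
begin

text \<open>A small subset is the range of a function on an initial segment of \<open>l\<close>;
  there are \<open>|l|\<close> domains, each with at most \<open>cexp_less l l\<close>
  functions.\<close>

lemma small_subsets_le_cexp_less: "|small_subsets l (Field l)| \<le>o cexp_less l l"
proof -
  let ?R = "{l ^c m' | m' :: 'a rel. Card_order m' \<and> m' <o l}"
  let ?F = "\<lambda>w. Func (underS l w) (Field l)"
  have "\<forall>r\<in>?R. Card_order r" using Card_order_cexp by blast
  note spec = card_sup_spec[OF this]
  have card: "Card_order (cexp_less l l)" using spec by (simp add: cexp_less_def)
  have F_le: "|?F w| \<le>o cexp_less l l" if "w \<in> Field l" for w
  proof -
    have "l ^c |underS l w| \<in> ?R" using small_underS[OF that] card_of_Card_order by blast
    then have "l ^c |underS l w| \<le>o cexp_less l l" using spec by (simp add: cexp_less_def)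
    then show ?thesis by (simp add: cexp_def Field_card_of)
  qed
  \<comment> \<open>Constant functions on a nonempty segment show that \<open>|l|\<close> is at most
    \<open>cexp_less l l\<close>.\<close>
  obtain w where w: "w \<in> Field l" "infinite (underS l w)" by (rule infinite_underS)
  then obtain a where a: "a \<in> underS l w" by fastforce
  have "|Field l| \<le>o |?F w|"
  proof (rule card_inj_image_le)
    let ?c = "\<lambda>x d. if d \<in> underS l w then x else undefined"
    show "inj_on ?c (Field l)"
    proof (rule inj_onI)
      fix x y assume "?c x = ?c y"
      from fun_cong[OF this, of a] show "x = y" using a by simp
    qed
    show "?c ` Field l \<subseteq> ?F w" by (auto simp: Func_def)
  qed
  then have l_le: "|Field l| \<le>o cexp_less l l" using F_le[OF w(1)] by (rule ordLeq_transitive)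
  then have inf: "infinite (Field (cexp_less l l))"
    using card_le_order[OF card] infinite_l card_of_ordLeq_infinite by blast
  have "small_subsets l (Field l) \<subseteq> (\<Union>w\<in>Field l. (\<lambda>g. g ` underS l w) ` ?F w)"
  proof
    fix A assume "A \<in> small_subsets l (Field l)"
    then have A: "A \<subseteq> Field l" "|A| <o l" by (auto simp: small_subsets_def)
    obtain v where v: "v \<in> Field l" "|A| =o |underS l v|"
      using card_less_underS[OF card_l A(2)] by blast
    obtain h where h: "bij_betw h (underS l v) A"
      using card_of_ordIso[of "underS l v" A] ordIso_symmetric[OF v(2)] by blast
    let ?g = "\<lambda>d. if d \<in> underS l v then h d else undefined"
    have "?g ` underS l v = A" using h by (simp add: bij_betw_def)
    moreover have "?g \<in> ?F v" using h A(1) by (auto simp: Func_def bij_betw_def)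
    ultimately show "A \<in> (\<Union>w\<in>Field l. (\<lambda>g. g ` underS l w) ` ?F w)" using v(1) by blast
  qed
  then have "|small_subsets l (Field l)| \<le>o |\<Union>w\<in>Field l. (\<lambda>g. g ` underS l w) ` ?F w|"
    by (rule card_of_mono1)
  also have "|\<Union>w\<in>Field l. (\<lambda>g. g ` underS l w) ` ?F w| \<le>o cexp_less l l"
  proof (rule card_of_UNION_ordLeq_infinite_Field[OF inf card l_le], rule ballI)
    fix w assume "w \<in> Field l"
    then show "|(\<lambda>g. g ` underS l w) ` ?F w| \<le>o cexp_less l l"
      by (rule ordLeq_transitive[OF card_of_image F_le])
  qed
  finally show ?thesis .
qed

lemma cf_small_subsets_dominating:
  obtains A where "A \<subseteq> small_subsets l (Field l)" "cf_small_subsets l l = |A|"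
    "\<And>B. B \<in> small_subsets l (Field l) \<Longrightarrow> \<exists>C\<in>A. B \<subseteq> C"
    "|A| \<le>o |small_subsets l (Field l)|"
proof -
  let ?S = "small_subsets l (Field l)"
  define O' where "O' = {(A, B). A \<in> ?S \<and> B \<in> ?S \<and> A \<subseteq> B}"
  have Field: "Field O' = ?S" by (auto simp: O'_def Field_def)
  have "Refl O'" by (rule refl_onI) (simp add: Field, simp add: O'_def)
  note spec = cofinality_spec[OF this]
  have "dominating ?S O'" unfolding dominating_def Field by (auto simp: O'_def)
  then have le: "cofinality O' \<le>o |?S|" using spec by simp
  obtain A where A: "dominating A O'" "cofinality O' = |A|" using spec by blast
  have "A \<subseteq> ?S" using A(1) by (simp add: dominating_def Field)
  moreover have "cf_small_subsets l l = |A|" using A(2) by (simp add: cf_small_subsets_def O'_def)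
  moreover have "\<exists>C\<in>A. B \<subseteq> C" if "B \<in> ?S" for B
  proof -
    have "\<exists>C\<in>A. (B, C) \<in> O'" using A(1) that unfolding dominating_def Field by blast
    then show ?thesis by (auto simp: O'_def)
  qed
  ultimately show thesis using le A(2) by (intro that[of A]) simp_all
qed

lemma cf_small_subsets_le: "cf_small_subsets l l \<le>o cexp_less l l"
proof (rule cf_small_subsets_dominating)
  fix A assume A: "cf_small_subsets l l = |A|" "|A| \<le>o |small_subsets l (Field l)|"
  show ?thesis
    unfolding A(1) by (rule ordLeq_transitive[OF A(2) small_subsets_le_cexp_less])
qed

text \<open>A subset \<open>X\<close> of \<open>l\<close> is the union of its traces on a short cofinal set of initial segments, and
  the set of these traces, coded by ordinals, is contained in a member of the dominating family.\<close>

lemma Pow_le_cf_small_subsets: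
  assumes "strong_limit l"
  shows "|Pow (Field l)| \<le>o cf_small_subsets l l"
proof (rule cf_small_subsets_dominating)
  fix A assume A: "A \<subseteq> small_subsets l (Field l)" "cf_small_subsets l l = |A|"
    "\<And>B. B \<in> small_subsets l (Field l) \<Longrightarrow> \<exists>C\<in>A. B \<subseteq> C"
  obtain E where E: "E \<subseteq> Field l" "cofinal E l" "|E| <o l" by (rule short_cofinal)
  obtain j where j: "inj_on j bounded_subsets" "\<And>P. P \<in> bounded_subsets \<Longrightarrow> j P \<in> Field l"
    using card_bounded_subsets[OF assms] by (rule card_leE) blast
  define dec where "dec = (\<lambda>S. \<Union>{P \<in> bounded_subsets. j P \<in> S})"
  have "Pow (Field l) \<subseteq> (\<Union>Z\<in>A. dec ` Pow Z)"
  proof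
    fix X assume "X \<in> Pow (Field l)"
    then have X: "X \<subseteq> Field l" by simp
    define tr where "tr = (\<lambda>e. X \<inter> underS l e) ` E"
    have tr: "tr \<subseteq> bounded_subsets" using E(1) unfolding tr_def bounded_subsets_def by blast
    have "j ` tr \<subseteq> Field l" using tr j(2) by blast
    moreover have "|j ` tr| <o l" unfolding tr_def by (intro small_image E(3))
    ultimately obtain Z where Z: "Z \<in> A" "j ` tr \<subseteq> Z" using A(3)[of "j ` tr"] by (auto simp: small_subsets_def)
    have "{P \<in> bounded_subsets. j P \<in> j ` tr} = tr"
      using tr inj_on_image_mem_iff[OF j(1) _ tr] by blast
    moreover have "\<Union>tr = X"
    proof
      show "\<Union>tr \<subseteq> X" by (auto simp: tr_def)
      show "X \<subseteq> \<Union>tr"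
      proof
        fix x assume x: "x \<in> X"
        then obtain e where "e \<in> E" "x \<noteq> e" "(x, e) \<in> l" using E(2) X unfolding cofinal_def by blast
        then show "x \<in> \<Union>tr" using x by (auto simp: tr_def underS_def)
      qed
    qed
    ultimately have "X = dec (j ` tr)" by (simp add: dec_def)
    then show "X \<in> (\<Union>Z\<in>A. dec ` Pow Z)" using Z by blast
  qed
  then have "|Pow (Field l)| \<le>o |\<Union>Z\<in>A. dec ` Pow Z|" by (rule card_of_mono1)
  also have "|\<Union>Z\<in>A. dec ` Pow Z| \<le>o |A <+> Field l|"
  proof (rule card_of_UNION_ordLeq_infinite)
    show "infinite (A <+> Field l)" using infinite_l by simp
    show "|A| \<le>o |A <+> Field l|" by (rule card_of_Plus1)
    show "\<forall>Z\<in>A. |dec ` Pow Z| \<le>o |A <+> Field l|"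
    proof
      fix Z assume "Z \<in> A"
      then have "|Z| <o l" using A(1) by (auto simp: small_subsets_def)
      then have "|Pow Z| \<le>o |Field l|"
        using small_Pow[OF assms] card_less_order[OF card_l] ordLess_imp_ordLeq by blast
      then have "|dec ` Pow Z| \<le>o |Field l|" by (rule ordLeq_transitive[OF card_of_image])
      then show "|dec ` Pow Z| \<le>o |A <+> Field l|" by (rule ordLeq_transitive[OF _ card_of_Plus2])
    qed
  qed
  finally have le: "|Pow (Field l)| \<le>o |A <+> Field l|" .
  \<comment> \<open>The summand \<open>l\<close> is absorbed: by Cantor, \<open>|A|\<close> cannot
    be at most \<open>|l|\<close>.\<close>
  have "|Pow (Field l)| \<le>o |A|"
  proof (cases "|A| \<le>o |Field l|")
    case True
    then have "|Pow (Field l)| \<le>o |Field l|"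
      using ordLeq_ordIso_trans[OF le card_of_Plus_infinite2[OF infinite_l True]] by simp
    then show ?thesis using card_of_Pow[of "Field l"] not_ordLess_ordLeq by blast
  next
    case False
    then have "|Field l| \<le>o |A|" using card_not_le_iff ordLess_imp_ordLeq by blast
    moreover from this have "infinite A" using infinite_l card_of_ordLeq_infinite by blast
    ultimately show ?thesis using ordLeq_ordIso_trans[OF le card_of_Plus_infinite1] by simp
  qed
  then show ?thesis by (simp add: A(2))
qed

text \<open>A successor cardinal below the limit cardinal \<open>l\<close>, realised as an initial
  segment of \<open>l\<close>.\<close>

lemma regular_above:
  assumes "|A| <o l"
  obtains w where "w \<in> Field l" "regular_cardinal (below l w)" "|A| <o below l w" "below l w <o l"
proof -
  obtain v where v: "v \<in> Field l" "infinite (underS l v)" "|A| \<le>o |underS l v|"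
    using underS_bound[OF assms assms] by blast
  let ?s = "cardSuc |underS l v|"
  have reg: "regular_cardinal ?s" by (rule regular_cardSuc[OF v(2)])
  note s = regular_stable[OF reg]
  have "?s <o l"
    using regular_less_l[OF reg small_underS[OF v(1)] ordLeq_reflexive[OF s(2)]] .
  then have "|Field ?s| <o l" using order_less_card[OF s(1)] by blast
  then obtain w where w: "w \<in> Field l" "|Field ?s| =o below l w"
    using card_less_underS[OF card_l] by blast
  have iso: "?s =o below l w"
    using ordIso_symmetric[OF card_of_Field_ordIso[OF s(1)]] w(2) by (rule ordIso_transitive)
  then have card: "Card_order (below l w)" using s(1) Card_order_ordIso2 by blast
  have "|Field ?s| =o |Field (below l w)|" by (rule card_of_cong[OF iso])
  then have inf: "infinite (Field (below l w))" using s(3) card_of_ordIso_finite by blast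
  have "regular_cardinal (below l w)"
    unfolding regular_cardinal_def cinfinite_def
    by (intro conjI card inf stable_regularCard stable_ordIso1[OF s(4)] ordIso_symmetric[OF iso])
  moreover have "|A| <o below l w"
    using ordLeq_ordLess_trans[OF v(3) cardSuc_greater[OF card_of_Card_order]] iso
    by (rule ordLess_ordIso_trans)
  moreover have "below l w <o l" using ordIso_symmetric[OF iso] \<open>?s <o l\<close> by (rule ordIso_ordLess_trans)
  ultimately show thesis using that w(1) by blast
qed

text \<open>If \<open>|Pow B| \<le> |Pow T|\<close> for all small \<open>B\<close>, a subset of \<open>l\<close> would be coded by its traces on a
  short cofinal set of initial segments, that is, by a subset of a small product.\<close>

lemma Pow_less_small:
  assumes T: "|T| <o l" and less: "|Pow T| <o |Pow (Field l)|"
  shows "\<exists>B\<subseteq>Field l. |B| <o l \<and> |Pow T| <o |Pow B|"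
proof (rule ccontr)
  assume neg: "\<not> ?thesis"
  have le: "|Pow B| \<le>o |Pow T|" if "B \<subseteq> Field l" "|B| <o l" for B
  proof (rule ccontr)
    assume "\<not> |Pow B| \<le>o |Pow T|"
    then have "|Pow T| <o |Pow B|" by (simp add: card_not_le_iff)
    with that neg show False by blast
  qed
  obtain E where E: "E \<subseteq> Field l" "cofinal E l" "|E| <o l" by (rule short_cofinal)
  define h where "h = (\<lambda>e. SOME h. inj_on h (Pow (underS l e)) \<and> h ` Pow (underS l e) \<subseteq> Pow T)"
  have h: "inj_on (h e) (Pow (underS l e)) \<and> h e ` Pow (underS l e) \<subseteq> Pow T" if "e \<in> E" for e
  proof -
    have "e \<in> Field l" using that E(1) by blast
    then have "|Pow (underS l e)| \<le>o |Pow T|" using le[OF underS_subset_Field small_underS] by blast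
    then have "\<exists>h. inj_on h (Pow (underS l e)) \<and> h ` Pow (underS l e) \<subseteq> Pow T"
      using card_of_ordLeq[of "Pow (underS l e)" "Pow T"] by blast
    then show ?thesis unfolding h_def by (rule someI_ex)
  qed
  define code where "code = (\<lambda>X. {(e, a). e \<in> E \<and> a \<in> h e (X \<inter> underS l e)})"
  have "|Pow (Field l)| \<le>o |Pow (E \<times> T)|"
  proof (rule card_inj_image_le)
    have "h e (X \<inter> underS l e) \<subseteq> T" if "e \<in> E" for e X
    proof -
      have "h e (X \<inter> underS l e) \<in> Pow T" by (rule subsetD[OF conjunct2[OF h[OF that]]]) blast
      then show ?thesis by simp
    qed
    then show "code ` Pow (Field l) \<subseteq> Pow (E \<times> T)" by (auto simp: code_def)
    show "inj_on code (Pow (Field l))"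
    proof (rule inj_onI)
      fix X X' assume X: "X \<in> Pow (Field l)" "X' \<in> Pow (Field l)" "code X = code X'"
      have eq: "X \<inter> underS l e = X' \<inter> underS l e" if e: "e \<in> E" for e
      proof -
        have "a \<in> h e (X \<inter> underS l e) \<longleftrightarrow> a \<in> h e (X' \<inter> underS l e)" for a
        proof -
          have "(e, a) \<in> code X \<longleftrightarrow> (e, a) \<in> code X'" using X(3) by simp
          then show ?thesis using e by (simp add: code_def)
        qed
        then have "h e (X \<inter> underS l e) = h e (X' \<inter> underS l e)" by blast
        then show ?thesis
          using inj_onD[OF conjunct1[OF h[OF e]], of "X \<inter> underS l e" "X' \<inter> underS l e"] by simp
      qed
      have "x \<in> X \<longleftrightarrow> x \<in> X'" if x: "x \<in> Field l" for x
      proof -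
        obtain e where "e \<in> E" "x \<noteq> e" "(x, e) \<in> l" using E(2) x unfolding cofinal_def by blast
        then have "e \<in> E" "x \<in> underS l e" by (simp_all add: underS_def)
        then show ?thesis using eq[of e] by blast
      qed
      then show "X = X'" using X by blast
    qed
  qed
  moreover have "|Pow (E \<times> T)| \<le>o |Pow T|"
  proof -
    obtain w where w: "w \<in> Field l" "|E \<times> T| =o |underS l w|"
      using card_less_underS[OF card_l small_Times[OF E(3) T]] by blast
    have "|Pow (E \<times> T)| \<le>o |Pow (underS l w)|" by (rule card_Pow_mono[OF ordIso_imp_ordLeq[OF w(2)]])
    then show ?thesis using le[OF underS_subset_Field small_underS[OF w(1)]] by (rule ordLeq_transitive)
  qed
  ultimately have "|Pow (Field l)| \<le>o |Pow T|" by (rule ordLeq_transitive)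
  then show False using less not_ordLess_ordLeq by blast
qed

end

text \<open>Images of dominating sets dominate; conversely, choosing preimages above the points of a
  dominating set of \<open>k\<close> gives one for \<open>l\<close>.\<close>

lemma cofinality_ordIso_if_monotone_cofinal:
  assumes l: "Well_order l" and k: "Well_order k"
    and no_max: "\<And>y. y \<in> Field k \<Longrightarrow> \<exists>z\<in>Field k. y \<in> underS k z"
    and f: "\<And>x. x \<in> Field l \<Longrightarrow> f x \<in> Field k"
    and mono: "\<And>x y. (x, y) \<in> l \<Longrightarrow> (f x, f y) \<in> k"
    and cofinal: "\<And>y. y \<in> Field k \<Longrightarrow> \<exists>x\<in>Field l. (y, f x) \<in> k"
  shows "cofinality l =o cofinality k"
proof -
  have "Refl l" "Refl k" using l k wo_rel.REFL by (auto simp: wo_rel_def)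
  note spec = cofinality_spec[OF \<open>Refl l\<close>] cofinality_spec[OF \<open>Refl k\<close>]
  obtain A where A: "dominating A l" "cofinality l = |A|" using spec(1) by blast
  obtain B where B: "dominating B k" "cofinality k = |B|" using spec(2) by blast
  have "dominating (f ` A) k"
    unfolding dominating_def
  proof (intro conjI ballI)
    show "f ` A \<subseteq> Field k" using A(1) f by (auto simp: dominating_def)
    fix y assume "y \<in> Field k"
    then obtain x where x: "x \<in> Field l" "(y, f x) \<in> k" using cofinal by blast
    then obtain a where a: "a \<in> A" "(x, a) \<in> l" using A(1) by (auto simp: dominating_def)
    have "(y, f a) \<in> k" by (rule wo_trans[OF k x(2) mono[OF a(2)]])
    then show "\<exists>z\<in>f ` A. (y, z) \<in> k" using a(1) by blast
  qed
  then have "cofinality k \<le>o |f ` A|" using spec(2) by blast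
  then have 1: "cofinality k \<le>o cofinality l"
    unfolding A(2) by (rule ordLeq_transitive[OF _ card_of_image])
  define g where "g = (\<lambda>y. SOME x. x \<in> Field l \<and> (y, f x) \<in> k)"
  have g: "g y \<in> Field l \<and> (y, f (g y)) \<in> k" if "y \<in> Field k" for y
  proof -
    have "\<exists>x. x \<in> Field l \<and> (y, f x) \<in> k" using cofinal[OF that] by blast
    then show ?thesis unfolding g_def by (rule someI_ex)
  qed
  have "dominating (g ` B) l"
    unfolding dominating_def
  proof (intro conjI ballI)
    have BF: "B \<subseteq> Field k" using B(1) by (simp add: dominating_def)
    show "g ` B \<subseteq> Field l" using BF g by blast
    fix x assume x: "x \<in> Field l"
    \<comment> \<open>As \<open>f\<close> may be constant on stretches, only a strict inequality
      between values can be reflected to arguments.\<close>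
    obtain z where z: "z \<in> Field k" "f x \<in> underS k z" using no_max[OF f[OF x]] by blast
    then obtain b where b: "b \<in> B" "(z, b) \<in> k" using B(1) by (auto simp: dominating_def)
    have gb: "g b \<in> Field l" "(b, f (g b)) \<in> k" using g BF b(1) by blast+
    have "f x \<in> underS k (f (g b))"
      by (rule wo_less_le_trans[OF k z(2) wo_trans[OF k b(2) gb(2)]])
    then have "(g b, x) \<notin> l" using mono[of "g b" x] wo_not_less[OF k, of "f (g b)" "f x"] by blast
    then have "x \<in> underS l (g b)" using wo_not_le_iff[OF l gb(1) x] by blast
    then have "(x, g b) \<in> l" by (rule underS_le)
    then show "\<exists>z\<in>g ` B. (x, z) \<in> l" using b(1) by blast
  qed
  then have "cofinality l \<le>o |g ` B|" using spec(1) by blast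
  then have "cofinality l \<le>o cofinality k"
    unfolding B(2) by (rule ordLeq_transitive[OF _ card_of_image])
  with 1 show ?thesis by (simp add: ordIso_iff_ordLeq)
qed

subsection \<open>Singular cardinals as limits of regular ones\<close>

context indecomposable
begin

text \<open>After each \<open>Y i\<close> is injected into \<open>l\<close>, indecomposability gives
  every \<open>x\<close> a small set \<open>W x\<close> containing almost all of its codes. There
  are fewer than \<open>r\<close> such sets, so \<open>r\<close> many \<open>x\<close> share one
  \<open>V\<close>; restricting each \<open>Y i\<close> to the codes in \<open>V\<close> covers
  them.\<close>

lemma fibre_few_covers:
  fixes r :: "'b rel"
  assumes reg: "regular_cardinal r" and cov: "covers F l (Field r)"
    and small: "|small_subsets l (Field l)| <o r"
  shows "few_covers F l (Field r)"
proof -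
  note r = regular_stable[OF reg]
  obtain Y where Y: "\<And>i. |Y i| \<le>o l" "\<And>x. x \<in> Field r \<Longrightarrow> \<forall>\<^sub>F i in F. x \<in> Y i"
    using cov unfolding covers_def by blast
  define j where "j = (\<lambda>i. SOME j. inj_on j (Y i) \<and> j ` Y i \<subseteq> Field l)"
  have j: "inj_on (j i) (Y i) \<and> j i ` Y i \<subseteq> Field l" for i
  proof -
    have "|Y i| \<le>o |Field l|" using Y(1) card_le_order[OF card_l] by blast
    then have "\<exists>j. inj_on j (Y i) \<and> j ` Y i \<subseteq> Field l" using card_of_ordLeq[of "Y i" "Field l"] by blast
    then show ?thesis unfolding j_def by (rule someI_ex)
  qed
  define W where "W = (\<lambda>x. SOME W. W \<subseteq> Field l \<and> |W| <o l \<and> (\<forall>\<^sub>F i in F. j i x \<in> W))"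
  have W: "W x \<subseteq> Field l \<and> |W x| <o l \<and> (\<forall>\<^sub>F i in F. j i x \<in> W x)" if x: "x \<in> Field r" for x
  proof -
    have "|Field l| \<le>o l" using card_of_Field_ordIso[OF card_l] by (rule ordIso_imp_ordLeq)
    moreover have "\<forall>\<^sub>F i in F. j i x \<in> Field l" using Y(2)[OF x] by eventually_elim (use j in blast)
    ultimately obtain V where "V \<subseteq> Field l" "|V| <o l" "\<forall>\<^sub>F i in F. j i x \<in> V" by (rule small_values)
    then have "\<exists>W. W \<subseteq> Field l \<and> |W| <o l \<and> (\<forall>\<^sub>F i in F. j i x \<in> W)" by (intro exI conjI)
    then show ?thesis unfolding W_def by (rule someI_ex)
  qed
  let ?S = "small_subsets l (Field l)"
  define K where "K = (\<lambda>V. {x \<in> Field r. W x = V})"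
  have "\<exists>V\<in>?S. \<not> |K V| <o r"
  proof (rule ccontr)
    assume "\<not> ?thesis"
    then have "|\<Union>V\<in>?S. K V| <o r" using stable_UNION[OF r(4) small] by blast
    moreover have "Field r \<subseteq> (\<Union>V\<in>?S. K V)" using W by (auto simp: K_def small_subsets_def)
    ultimately have "|Field r| <o r" using ordLeq_ordLess_trans[OF card_of_mono1] by blast
    then show False using card_of_Field_ordIso[OF r(1)] not_ordLess_ordIso by blast
  qed
  then obtain V where V: "V \<in> ?S" "\<not> |K V| <o r" by blast
  have "r \<le>o |K V|" by (rule iffD1[OF not_card_less_order[OF r(1)] V(2)])
  then have "|Field r| \<le>o |K V|" by (rule ordIso_ordLeq_trans[OF card_of_Field_ordIso[OF r(1)]])
  moreover have "few_covers F l (K V)"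
  proof (rule few_coversI)
    show "|V| <o l" using V(1) by (simp add: small_subsets_def)
    have "|{x \<in> Y i. j i x \<in> V}| \<le>o |V|" for i using j[of i] by (intro card_vimage_le) blast
    then show "\<forall>\<^sub>F i in F. |{x \<in> Y i. j i x \<in> V}| \<le>o |V|" by (rule always_eventually[OF allI])
    show "\<forall>\<^sub>F i in F. x \<in> {x \<in> Y i. j i x \<in> V}" if "x \<in> K V" for x
    proof -
      have x: "x \<in> Field r" "W x = V" using that by (auto simp: K_def)
      have "\<forall>\<^sub>F i in F. j i x \<in> V" using W[OF x(1)] x(2) by simp
      with Y(2)[OF x(1)] show ?thesis by eventually_elim simp
    qed
  qed
  ultimately show ?thesis using few_covers_le by blast
qed

text \<open>Parts of \<open>k\<close> smaller than \<open>k\<close> are covered via regular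
  cardinals, which must exceed the threshold \<open>|T|\<close>. The bound \<open>w e\<close> may
  vary with the part, so the point is to find one \<open>u\<close> that serves cofinally many
  \<open>e\<close>.\<close>

lemma few_covers_singular:
  fixes k :: "'b rel"
  assumes k: "singular_cardinal k" and cof: "\<not> cofinality l =o cofinality k"
    and T: "|T| <o k"
    and few: "\<And>r :: 'b rel. regular_cardinal r \<Longrightarrow> |T| <o r \<Longrightarrow> r \<le>o k \<Longrightarrow> few_covers F l (Field r)"
  shows "few_covers F l (Field k)"
proof -
  interpret K: singular k using k by unfold_locales
  have small: "few_covers F l B" if B: "|B| <o k" for B :: "'b set"
  proof -
    obtain v where v: "v \<in> Field k" "|B| \<le>o |underS k v|" "|T| \<le>o |underS k v|"
      using K.underS_bound[OF B T] by blast
    obtain w where w: "regular_cardinal (below k w)" "|underS k v| <o below k w" "below k w <o k"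
      by (rule K.regular_above[OF K.small_underS[OF v(1)]])
    note s = regular_stable[OF w(1)]
    have "few_covers F l (Field (below k w))"
      by (intro few w(1) ordLeq_ordLess_trans[OF v(3) w(2)] ordLess_imp_ordLeq[OF w(3)])
    moreover have "|B| \<le>o |Field (below k w)|"
    proof -
      have "|B| <o below k w" using v(2) w(2) by (rule ordLeq_ordLess_trans)
      then have "|B| <o |Field (below k w)|" by (rule iffD1[OF card_less_order[OF s(1)]])
      then show ?thesis by (rule ordLess_imp_ordLeq)
    qed
    ultimately show ?thesis by (rule few_covers_le)
  qed
  obtain E where E: "E \<subseteq> Field k" "cofinal E k" "|E| <o k" by (rule K.short_cofinal)
  have "\<exists>w Z. w \<in> Field l \<and> (\<forall>i. |Z i| \<le>o |underS l w| ) \<and> (\<forall>x\<in>underS k e. \<forall>\<^sub>F i in F. x \<in> Z i)"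
    if "e \<in> E" for e
  proof -
    have "few_covers F l (underS k e)" using small[OF K.small_underS] that E(1) by blast
    then show ?thesis unfolding few_covers_def by blast
  qed
  then obtain w Z where w: "\<And>e. e \<in> E \<Longrightarrow> w e \<in> Field l"
    and Z: "\<And>e i. e \<in> E \<Longrightarrow> |Z e i| \<le>o |underS l (w e)|"
      "\<And>e x. e \<in> E \<Longrightarrow> x \<in> underS k e \<Longrightarrow> \<forall>\<^sub>F i in F. x \<in> Z e i"
    by metis
  \<comment> \<open>\<open>E\<close> may have more than \<open>|l|\<close> elements, so the union of
    all the covers could be too large. Covering \<open>E\<close> itself leaves only few of its
    elements to be used at each index.\<close>
  obtain T' w' where w': "w' \<in> Field l" and T': "\<And>i. |T' i| \<le>o |underS l w'|"
      "\<And>e. e \<in> E \<Longrightarrow> \<forall>\<^sub>F i in F. e \<in> T' i"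
    using small[OF E(3)] unfolding few_covers_def by blast
  have "\<exists>u\<in>Field l. \<forall>x\<in>Field k. \<exists>e\<in>E. (w e, u) \<in> l \<and> x \<in> underS k e"
  proof (rule ccontr)
    assume neg: "\<not> ?thesis"
    \<comment> \<open>\<open>f u\<close> is the least point of \<open>k\<close> not below any
      \<open>e\<close> served by \<open>u\<close>. It is monotone in \<open>u\<close>, and cofinal
      because \<open>e\<close> is at most \<open>f (w e)\<close>; this would equate the
      cofinalities.\<close>
    define B where "B = (\<lambda>u. {x \<in> Field k. \<forall>e\<in>E. (w e, u) \<in> l \<longrightarrow> (e, x) \<in> k})"
    define f where "f = (\<lambda>u. wo_rel.minim k (B u))"
    have wo: "wo_rel k" using K.wo_l by (simp add: wo_rel_def)
    have B: "B u \<subseteq> Field k" "B u \<noteq> {}" if u: "u \<in> Field l" for u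
    proof -
      show "B u \<subseteq> Field k" by (auto simp: B_def)
      obtain x where x: "x \<in> Field k" "\<And>e. e \<in> E \<Longrightarrow> (w e, u) \<in> l \<Longrightarrow> x \<notin> underS k e"
        using neg u by blast
      have "(e, x) \<in> k" if "e \<in> E" "(w e, u) \<in> l" for e
        using x(2)[OF that] wo_not_le_iff[OF K.wo_l, of e x] x(1) E(1) that(1) by blast
      then show "B u \<noteq> {}" using x(1) by (auto simp: B_def)
    qed
    have f: "f u \<in> B u" if "u \<in> Field l" for u
      unfolding f_def by (rule wo_rel.minim_in[OF wo B[OF that]])
    have "cofinality l =o cofinality k"
    proof (rule cofinality_ordIso_if_monotone_cofinal[OF wo_l K.wo_l])
      show "\<exists>z\<in>Field k. y \<in> underS k z" if "y \<in> Field k" for y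
        using infinite_no_max[OF K.card_l K.infinite_l that] by blast
      show "f u \<in> Field k" if "u \<in> Field l" for u using f[OF that] B(1)[OF that] by blast
      show "(f u, f v) \<in> k" if uv: "(u, v) \<in> l" for u v
      proof -
        have uF: "u \<in> Field l" "v \<in> Field l" using uv by (auto simp: Field_def)
        have "B v \<subseteq> B u" using wo_trans[OF wo_l _ uv] by (auto simp: B_def)
        then have "f v \<in> B u" using f[OF uF(2)] by blast
        then show ?thesis unfolding f_def by (rule wo_rel.minim_least[OF wo B(1)[OF uF(1)]])
      qed
      show "\<exists>u\<in>Field l. (y, f u) \<in> k" if y: "y \<in> Field k" for y
      proof -
        obtain e where e: "e \<in> E" "(y, e) \<in> k" using E(2) y unfolding cofinal_def by blast
        have "(e, f (w e)) \<in> k"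
          using f[OF w[OF e(1)]] e(1) wo_refl[OF wo_l w[OF e(1)]] by (simp add: B_def)
        then have "(y, f (w e)) \<in> k" by (rule wo_trans[OF K.wo_l e(2)])
        then show ?thesis using w[OF e(1)] by blast
      qed
    qed
    with cof show False ..
  qed
  then obtain u where u: "u \<in> Field l" "\<And>x. x \<in> Field k \<Longrightarrow> \<exists>e\<in>E. (w e, u) \<in> l \<and> x \<in> underS k e"
    by blast
  obtain v where v: "v \<in> Field l" "infinite (underS l v)" "|underS l u| \<le>o |underS l v|"
    "|underS l w'| \<le>o |underS l v|"
    by (rule underS_bound[OF small_underS[OF u(1)] small_underS[OF w']])
  define E' where "E' = {e \<in> E. (w e, u) \<in> l}"
  show ?thesis
  proof (rule few_covers_underSI[OF v(1)])
    show "|\<Union>e\<in>T' i \<inter> E'. Z e i| \<le>o |underS l v|" for i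
    proof (rule card_of_UNION_ordLeq_infinite[OF v(2)])
      have "|T' i \<inter> E'| \<le>o |T' i|" by (rule card_of_mono1) blast
      then have "|T' i \<inter> E'| \<le>o |underS l w'|" using T'(1) by (rule ordLeq_transitive)
      then show "|T' i \<inter> E'| \<le>o |underS l v|" using v(4) by (rule ordLeq_transitive)
      show "\<forall>e\<in>T' i \<inter> E'. |Z e i| \<le>o |underS l v|"
      proof
        fix e assume "e \<in> T' i \<inter> E'"
        then have e: "e \<in> E" "(w e, u) \<in> l" by (auto simp: E'_def)
        have "|Z e i| \<le>o |underS l u|"
          by (rule ordLeq_transitive[OF Z(1)[OF e(1)] card_underS_mono[OF wo_l e(2)]])
        then show "|Z e i| \<le>o |underS l v|" using v(3) by (rule ordLeq_transitive)
      qed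
    qed
    show "\<forall>\<^sub>F i in F. x \<in> (\<Union>e\<in>T' i \<inter> E'. Z e i)" if x: "x \<in> Field k" for x
    proof -
      obtain e where e: "e \<in> E" "(w e, u) \<in> l" "x \<in> underS k e" using u(2)[OF x] by blast
      show ?thesis
        using T'(2)[OF e(1)] Z(2)[OF e(1,3)]
        by eventually_elim (use e in \<open>auto simp: E'_def\<close>)
    qed
  qed
qed

lemma few_covers_main:
  fixes k :: "'b rel"
  assumes k: "Card_order k" and lk: "l <o k" and cof: "\<not> cofinality l =o cofinality k"
    and cov: "covers F l (Field k)"
    and cases: "(strong_limit l \<and> cf_small_subsets l l <o ctwo ^c k) \<or> cexp_less l l <o k \<or>
      (regular_cardinal k \<and>
       \<not> (\<exists>A. A \<subseteq> Field l \<and> (\<forall>x \<in> A. regular_cardinal (below l x)) \<and>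
            |A| <o l \<and> cofinal A l \<and> in_pcf k (below l ` A)))"
  shows "few_covers F l (Field k)"
proof -
  have "|Field l| <o |Field k|"
    using lk card_less_order[OF k] order_less_card[OF card_l, of k] by blast
  then have infk: "infinite (Field k)"
    using infinite_l card_of_ordLeq_infinite ordLess_imp_ordLeq by blast
  have k_cases: "regular_cardinal k \<or> singular_cardinal k"
    using k infk by (auto simp: regular_cardinal_def singular_cardinal_def cinfinite_def)
  have cov_le: "covers F l (Field r)" if "r \<le>o k" for r :: "'b rel"
    using covers_le[OF cov card_of_mono2[OF that]] .
  from cases consider (a) "strong_limit l" "cf_small_subsets l l <o ctwo ^c k"
    | (b) "cexp_less l l <o k"
    | (c) "regular_cardinal k" "\<not> (\<exists>A. A \<subseteq> Field l \<and> (\<forall>x \<in> A. regular_cardinal (below l x)) \<and>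
            |A| <o l \<and> cofinal A l \<and> in_pcf k (below l ` A))"
    by blast
  then show ?thesis
  proof cases
    case a
    have "|Pow (Field l)| <o ctwo ^c k"
      using Pow_le_cf_small_subsets[OF a(1)] a(2) by (rule ordLeq_ordLess_trans)
    then have less: "|Pow (Field l)| <o |Pow (Field k)|"
      using ordIso_symmetric[OF Pow_Field_ordIso] by (rule ordLess_ordIso_trans)
    from k_cases show ?thesis
    proof
      assume "regular_cardinal k"
      then show ?thesis by (rule strong_limit_few_covers[OF a(1) _ lk cov less])
    next
      assume sing: "singular_cardinal k"
      interpret K: singular k using sing by unfold_locales
      have small: "|Field l| <o k" using lk order_less_card[OF card_l, of k] by blast
      \<comment> \<open>The inequality between the powers of \<open>l\<close> and \<open>k\<close>
        need not pass to the regular cardinals below \<open>k\<close>. It does above the size of a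
        small \<open>B\<close> that already has more than \<open>2^l\<close> subsets.\<close>
      have "\<exists>B\<subseteq>Field k. |B| <o k \<and> |Pow (Field l)| <o |Pow B|"
        by (rule K.Pow_less_small[OF small less])
      then obtain B :: "'b set" where B: "|B| <o k" "|Pow (Field l)| <o |Pow B|" by blast
      obtain v where v: "v \<in> Field k" "|B| \<le>o |underS k v|" "|Field l| \<le>o |underS k v|"
        using K.underS_bound[OF B(1) small] by blast
      show ?thesis
      proof (rule few_covers_singular[OF sing cof K.small_underS[OF v(1)]])
        fix r :: "'b rel" assume r: "regular_cardinal r" "|underS k v| <o r" "r \<le>o k"
        note r' = regular_stable[OF r(1)]
        have "|Field l| <o r" using v(3) r(2) by (rule ordLeq_ordLess_trans)
        then have "l <o r" using order_less_card[OF card_l, of r] by blast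
        moreover have "|Pow (Field l)| <o |Pow (Field r)|"
        proof -
          have "|B| <o r" using v(2) r(2) by (rule ordLeq_ordLess_trans)
          then have "|B| \<le>o |Field r|"
            using card_less_order[OF r'(1)] ordLess_imp_ordLeq by blast
          then show ?thesis by (rule ordLess_ordLeq_trans[OF B(2) card_Pow_mono])
        qed
        ultimately show "few_covers F l (Field r)"
          by (rule strong_limit_few_covers[OF a(1) r(1) _ cov_le[OF r(3)]])
      qed
    qed
  next
    case b
    have small: "|small_subsets l (Field l)| <o k"
      using small_subsets_le_cexp_less b by (rule ordLeq_ordLess_trans)
    from k_cases show ?thesis
    proof
      assume "regular_cardinal k"
      then show ?thesis using cov small by (rule fibre_few_covers)
    next
      assume "singular_cardinal k"
      then show ?thesis using cof small
        by (rule few_covers_singular) (rule fibre_few_covers[OF _ cov_le])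
    qed
  next
    case c
    show ?thesis
    proof (rule ccontr)
      assume "\<not> few_covers F l (Field k)"
      then interpret uncovered l F k using c(1) lk cov by unfold_locales
      show False using in_pcf_ladder c(2) by blast
    qed
  qed
qed

end

section \<open>Translation between ultrafilters and covers\<close>

lemma covers_if_regular_ultrafilter:
  fixes l :: "'a rel" and k :: "'b rel" and D :: "'i set set"
  assumes l: "Card_order l" and D: "D \<subseteq> Pow I" and reg: "regular_ultrafilter (cardSuc l) k D"
    and F: "\<And>P. eventually P F \<longleftrightarrow> {i \<in> I. P i} \<in> D"
  shows "covers F l (Field k)"
proof -
  obtain X where X: "\<forall>x\<in>Field k. X x \<in> D"
    "\<forall>A. A \<subseteq> Field k \<and> |A| =o cardSuc l \<longrightarrow> (\<Inter>x\<in>A. X x) = {}"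
    using reg unfolding regular_ultrafilter_def by (elim exE conjE) (rule that)
  show ?thesis
  proof (rule coversI)
    show "|{x \<in> Field k. i \<in> X x}| \<le>o l" for i
    proof (rule ccontr)
      let ?Y = "{x \<in> Field k. i \<in> X x}"
      assume "\<not> |?Y| \<le>o l"
      then have "l <o |?Y|"
        using not_ordLeq_iff_ordLess[OF Well_order_if_Card_order[OF l] card_of_Well_order] by blast
      \<comment> \<open>Regularity concerns sets of size exactly \<open>cardSuc l\<close>, so a
        subset of that size is extracted from the larger one.\<close>
      then have "cardSuc l \<le>o |?Y|" by (rule cardSuc_least[OF l card_of_Card_order])
      then have "|Field (cardSuc l)| \<le>o |?Y|"
        by (rule ordIso_ordLeq_trans[OF card_of_Field_ordIso[OF cardSuc_Card_order[OF l]]])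
      then obtain A where A: "A \<subseteq> ?Y" "|Field (cardSuc l)| =o |A|"
        using internalize_card_of_ordLeq2[of "Field (cardSuc l)" ?Y] by blast
      have "|A| =o cardSuc l"
        using ordIso_symmetric[OF A(2)] card_of_Field_ordIso[OF cardSuc_Card_order[OF l]]
        by (rule ordIso_transitive)
      then have "(\<Inter>x\<in>A. X x) = {}" using X(2)[rule_format, of A] A(1) by blast
      then show False using A(1) by blast
    qed
    show "\<forall>\<^sub>F i in F. x \<in> {x \<in> Field k. i \<in> X x}" if "x \<in> Field k" for x
    proof -
      have "{i \<in> I. x \<in> {x \<in> Field k. i \<in> X x}} = X x" using bspec[OF X(1) that] D that by blast
      then show ?thesis using bspec[OF X(1) that] by (simp add: F)
    qed
  qed
qed

text \<open>The sets \<open>Z i\<close> may attain the bound \<open>|underS l w|\<close>, so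
  \<open>l'\<close> is taken strictly above it: a set of size \<open>l'\<close> fits into no
  \<open>Z i\<close>.\<close>

lemma (in singular) regular_ultrafilter_if_few_covers:
  fixes k :: "'b rel"
  assumes few: "few_covers F l (Field k)" and F: "\<And>P. eventually P F \<longleftrightarrow> {i \<in> I. P i} \<in> D"
  shows "\<exists>l' :: 'a rel. Card_order l' \<and> cinfinite l' \<and> l' <o l \<and> regular_ultrafilter l' k D"
proof -
  obtain Z w where w: "w \<in> Field l"
    and Z: "\<And>i. |Z i| \<le>o |underS l w|" "\<And>x. x \<in> Field k \<Longrightarrow> \<forall>\<^sub>F i in F. x \<in> Z i"
    using few unfolding few_covers_def by blast
  obtain v where v: "regular_cardinal (below l v)" "|underS l w| <o below l v" "below l v <o l"
    by (rule regular_above[OF small_underS[OF w]])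
  have "(\<Inter>x\<in>A. {i \<in> I. x \<in> Z i}) = {}" if A: "|A| =o below l v" for A
  proof (rule ccontr)
    assume "\<not> ?thesis"
    then obtain i where "A \<subseteq> Z i" by blast
    then have "|A| \<le>o |underS l w|" by (rule ordLeq_transitive[OF card_of_mono1 Z(1)])
    then have "|A| <o below l v" using v(2) by (rule ordLeq_ordLess_trans)
    then show False using A not_ordLess_ordIso by blast
  qed
  moreover have "{i \<in> I. x \<in> Z i} \<in> D" if "x \<in> Field k" for x
    using Z(2)[OF that] by (simp add: F)
  ultimately have "regular_ultrafilter (below l v) k D"
    unfolding regular_ultrafilter_def by (intro exI[of _ "\<lambda>x. {i \<in> I. x \<in> Z i}"]) simp
  then show ?thesis using v(1,3) unfolding regular_cardinal_def by blast
qed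

theorem theorem6p5:
  fixes l :: "'a rel" and k :: "'b rel" and I :: "'i set" and D :: "'i set set"
  assumes "Card_order k" and "l <o k"
    and "singular_cardinal l"
    and "\<not> cofinality l =o cofinality k"
    and "ultrafilter_on I D"
    and "regular_ultrafilter (cardSuc l) k D"
  shows "(strong_limit l \<and> cexp_less l l <o ctwo ^c k \<longrightarrow> cf_small_subsets l l <o ctwo ^c k) \<and>
    ((strong_limit l \<and> cf_small_subsets l l <o ctwo ^c k) \<or>
     cexp_less l l <o k \<or>
     (regular_cardinal k \<and>
       \<not> (\<exists>A. A \<subseteq> Field l \<and> (\<forall>x \<in> A. regular_cardinal (below l x)) \<and>
            |A| <o l \<and> cofinal A l \<and> in_pcf k (below l ` A)))
     \<longrightarrow> decomposable l I D \<or>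
       (\<exists>l' :: 'a rel. Card_order l' \<and> cinfinite l' \<and> l' <o l \<and> regular_ultrafilter l' k D))"
proof (intro conjI impI)
  interpret singular l using assms(3) by unfold_locales
  show "cf_small_subsets l l <o ctwo ^c k" if "strong_limit l \<and> cexp_less l l <o ctwo ^c k"
    using cf_small_subsets_le conjunct2[OF that] by (rule ordLeq_ordLess_trans)
  assume cases: "(strong_limit l \<and> cf_small_subsets l l <o ctwo ^c k) \<or>
     cexp_less l l <o k \<or>
     (regular_cardinal k \<and>
       \<not> (\<exists>A. A \<subseteq> Field l \<and> (\<forall>x \<in> A. regular_cardinal (below l x)) \<and>
            |A| <o l \<and> cofinal A l \<and> in_pcf k (below l ` A)))"
  note U = assms(5)[unfolded ultrafilter_on_def]
  then have U_max: "\<forall>X. X \<subseteq> I \<longrightarrow> X \<in> D \<or> I - X \<in> D" by (elim conjE)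
  \<comment> \<open>The indices outside \<open>I\<close> form a null set of this filter.\<close>
  define F where "F = Abs_filter (\<lambda>P. {i \<in> I. P i} \<in> D)"
  have F: "eventually P F \<longleftrightarrow> {i \<in> I. P i} \<in> D" for P
    unfolding F_def
  proof (rule eventually_Abs_filter, rule is_filter.intro)
    show "{i \<in> I. True} \<in> D" using U by simp
    show "{i \<in> I. P i \<and> Q i} \<in> D" if "{i \<in> I. P i} \<in> D" "{i \<in> I. Q i} \<in> D" for P Q
    proof -
      have "{i \<in> I. P i} \<inter> {i \<in> I. Q i} \<in> D" using U that by blast
      moreover have "{i \<in> I. P i} \<inter> {i \<in> I. Q i} = {i \<in> I. P i \<and> Q i}" by blast
      ultimately show ?thesis by simp
    qed
    show "{i \<in> I. Q i} \<in> D" if "\<forall>i. P i \<longrightarrow> Q i" "{i \<in> I. P i} \<in> D" for P Q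
    proof -
      have "{i \<in> I. P i} \<subseteq> {i \<in> I. Q i}" "{i \<in> I. Q i} \<subseteq> I" using that(1) by blast+
      then show ?thesis using U that(2) by blast
    qed
  qed
  show "decomposable l I D \<or>
      (\<exists>l' :: 'a rel. Card_order l' \<and> cinfinite l' \<and> l' <o l \<and> regular_ultrafilter l' k D)"
  proof (cases "decomposable l I D")
    case False
    interpret indecomposable l F
    proof unfold_locales
      show "F \<noteq> bot" using U F[of "\<lambda>_. False"] by auto
      show "(\<forall>\<^sub>F i in F. P i) \<or> (\<forall>\<^sub>F i in F. \<not> P i)" for P
      proof -
        have "I - {i \<in> I. P i} = {i \<in> I. \<not> P i}" by blast
        then show ?thesis using spec[OF U_max, of "{i \<in> I. P i}"] by (simp add: F subset_eq)
      qed
      show "\<exists>W\<subseteq>Field l. |W| <o l \<and> (\<forall>\<^sub>F i in F. f i \<in> W)" if "\<And>i. f i \<in> Field l" for f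
      proof -
        have f: "f \<in> I \<rightarrow> Field l" using that by simp
        have "\<not> (\<forall>X. X \<subseteq> Field l \<and> |X| <o l \<longrightarrow> {i \<in> I. f i \<in> X} \<notin> D)"
        proof
          assume "\<forall>X. X \<subseteq> Field l \<and> |X| <o l \<longrightarrow> {i \<in> I. f i \<in> X} \<notin> D"
          with f have "decomposable l I D" unfolding decomposable_def by (intro exI conjI)
          with False show "False" ..
        qed
        then show ?thesis by (auto simp: F)
      qed
    qed
    have "D \<subseteq> Pow I" using U by blast
    then have "covers F l (Field k)"
      by (rule covers_if_regular_ultrafilter[OF card_l _ assms(6) F])
    then have "few_covers F l (Field k)"
      by (rule few_covers_main[OF assms(1,2,4) _ cases])
    then show ?thesis using regular_ultrafilter_if_few_covers[OF _ F] by blast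
  qed simp
qed

end
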